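(* Let $g\geq 2$ and $m\geq 2$ be integers and let $\mathsf{D}_{2m}$ be the dihedral group of order $2m$. Then the number $N_g(\mathsf{D}_{2m})$ of admissible epimorphisms $\varphi\colon\mathsf{B}_2(\Sigma_g)\to\mathsf{D}_{2m}$ is given by $$N_g(\mathsf{D}_{2m})=\varepsilon\cdot mJ_{2g}(m),\qquad\text{where}\quad \varepsilon=\begin{cases}1&\text{if } m\notin\{2,4\},\\ 2&\text{if } m=4,\\ 3\cdot 2^{2g-1}&\text{if } m=2.\end{cases}$$
   Context: Commutators are $[x,y]=xyx^{-1}y^{-1}$. Let $\Sigma_g$ be a compact Riemann surface of genus $g$. The full braid group on two strings $\mathsf{B}_2(\Sigma_g)\simeq\pi_1(\operatorname{Sym}^2\Sigma_g-\delta)$ (with $\delta$ the diagonal) is the group generated by $a_1,b_1,\dots,a_g,b_g,\sigma$ subject to the relations: $[a_i,\sigma^{-1}a_i\sigma^{-1}]=1$ and $[b_i,\sigma^{-1}b_i\sigma^{-1}]=1$ for $1\le i\le g$; $[a_i,\sigma^{-1}a_j\sigma]=[a_i,\sigma^{-1}b_j\sigma]=[b_i,\sigma^{-1}a_j\sigma]=[b_i,\sigma^{-1}b_j\sigma]=1$ for $j<i$; $[a_i,\sigma^{-1}b_i\sigma^{-1}]=\sigma^2$ for $1\le i\le g$; and $[a_1,b_1^{-1}]\cdots[a_g,b_g^{-1}]=\sigma^2$. For a finite group $G$, a group epimorphism $\varphi\colon\mathsf{B}_2(\Sigma_g)\to G$ is called admissible if $\varphi(\sigma)$ has order $n\ge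 2$ (i.e. $\varphi(\sigma)\neq 1$). $N_g(G)$ denotes the total number of admissible epimorphisms $\mathsf{B}_2(\Sigma_g)\to G$. $\mathsf{D}_{2m}=\langle x,y\mid x^2=1,\ y^m=1,\ xyx^{-1}=y^{-1}\rangle$; for $m=2$ this is $\mathsf{D}_4\simeq\mathsf{C}_2\times\mathsf{C}_2$, where $\mathsf{C}_m$ denotes the cyclic group of order $m$. $J_k(m)$ is the Jordan totient: the number of ordered $k$-tuples of elements of $\mathsf{C}_m$ generating $\mathsf{C}_m$; equivalently $J_k(m)=m^k\prod_{p\mid m}(1-p^{-k})$, the product being over the distinct primes $p$ dividing $m$. *)

theory Defs
  imports "HOL-Algebra.Elementary_Groups" "HOL-Library.FuncSet"
begin

section \<open>Groups given by generators and relations\<close>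

text \<open>A letter \<open>(x, True)\<close> stands for the generator \<open>x\<close> and \<open>(x, False)\<close> for its formal inverse.
  A relation is a pair \<open>(l, r)\<close> of words, read as the equation \<open>l = r\<close>.\<close>

type_synonym 'a gword = "('a \<times> bool) list"

definition gwords :: "'a set \<Rightarrow> 'a gword set" where
  "gwords X = lists (X \<times> UNIV)"

definition gen :: "'a \<Rightarrow> 'a gword" where
  "gen x = [(x, True)]"

definition winv :: "'a gword \<Rightarrow> 'a gword" where
  "winv w = rev (map (\<lambda>(x, b). (x, \<not> b)) w)"

definition wcomm :: "'a gword \<Rightarrow> 'a gword \<Rightarrow> 'a gword" where
  "wcomm u v = u @ v @ winv u @ winv v"

text \<open>Only relations between words over \<open>X\<close> take part; all presentations below
  consist of such relations (see the lemmas \<open>braid_rels_words\<close>, \<open>dihedral_rels_words\<close>).\<close>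

inductive_set word_cong :: "'a set \<Rightarrow> ('a gword \<times> 'a gword) set \<Rightarrow> ('a gword \<times> 'a gword) set"
  for X :: "'a set" and R :: "('a gword \<times> 'a gword) set" where
  refl: "w \<in> gwords X \<Longrightarrow> (w, w) \<in> word_cong X R"
| sym: "(u, v) \<in> word_cong X R \<Longrightarrow> (v, u) \<in> word_cong X R"
| trans: "(u, v) \<in> word_cong X R \<Longrightarrow> (v, w) \<in> word_cong X R \<Longrightarrow> (u, w) \<in> word_cong X R"
| cancel: "u \<in> gwords X \<Longrightarrow> v \<in> gwords X \<Longrightarrow> x \<in> X
    \<Longrightarrow> (u @ [(x, b), (x, \<not> b)] @ v, u @ v) \<in> word_cong X R"
| rel: "(l, r) \<in> R \<Longrightarrow> l \<in> gwords X \<Longrightarrow> r \<in> gwords X \<Longrightarrow> u \<in> gwords X \<Longrightarrow> v \<in> gwords X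
    \<Longrightarrow> (u @ l @ v, u @ r @ v) \<in> word_cong X R"

definition word_class :: "'a set \<Rightarrow> ('a gword \<times> 'a gword) set \<Rightarrow> 'a gword \<Rightarrow> 'a gword set" where
  "word_class X R w = word_cong X R `` {w}"

definition presented_group :: "'a set \<Rightarrow> ('a gword \<times> 'a gword) set \<Rightarrow> 'a gword set monoid" where
  "presented_group X R =
    \<lparr>carrier = gwords X // word_cong X R,
     monoid.mult = (\<lambda>U V. \<Union>u\<in>U. \<Union>v\<in>V. word_class X R (u @ v)),
     one = word_class X R []\<rparr>"

lemma gwords_Nil [simp]: "[] \<in> gwords X"
  and gwords_append [simp]: "u @ v \<in> gwords X \<longleftrightarrow> u \<in> gwords X \<and> v \<in> gwords X"
  and gwords_Cons [simp]: "p # w \<in> gwords X \<longleftrightarrow> fst p \<in> X \<and> w \<in> gwords X"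
  and gen_in_gwords [simp]: "gen x \<in> gwords X \<longleftrightarrow> x \<in> X"
  by (cases p; auto simp: gwords_def gen_def)+

lemma winv_in_gwords [simp]: "winv w \<in> gwords X \<longleftrightarrow> w \<in> gwords X"
  by (induction w) (auto simp: winv_def)

lemma wcomm_in_gwords [simp]: "wcomm u v \<in> gwords X \<longleftrightarrow> u \<in> gwords X \<and> v \<in> gwords X"
  by (auto simp: wcomm_def)

lemma word_cong_gwords:
  assumes "(u, v) \<in> word_cong X R" shows "u \<in> gwords X \<and> v \<in> gwords X"
  using assms by induction auto

lemma word_cong_append:
  assumes "(u, v) \<in> word_cong X R" "s \<in> gwords X" "t \<in> gwords X"
  shows "(s @ u @ t, s @ v @ t) \<in> word_cong X R"
  using assms
proof induction
  case (cancel u v x b)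
  then show ?case using word_cong.cancel[of "s @ u" X "v @ t" x b R] by simp
next
  case (rel l r u v)
  then show ?case using word_cong.rel[of l r R X "s @ u" "v @ t"] by simp
next
  case (refl w)
  then show ?case by (simp add: word_cong.refl)
next
  case (sym u v)
  then show ?case by (simp add: word_cong.sym)
next
  case (trans u v w)
  then show ?case by (metis word_cong.trans)
qed

lemma equiv_word_cong: "equiv (gwords X) (word_cong X R)"
proof (rule equivI)
  show "word_cong X R \<subseteq> gwords X \<times> gwords X"
    using word_cong_gwords by fastforce
  show "refl_on (gwords X) (word_cong X R)"
    by (simp add: refl_on_def word_cong.refl)
  show "sym (word_cong X R)"
    by (rule symI) (rule word_cong.sym)
  show "trans (word_cong X R)"
    by (rule transI) (rule word_cong.trans)
qed

lemma word_cong_append2: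
  assumes "(u, u') \<in> word_cong X R" "(v, v') \<in> word_cong X R"
  shows "(u @ v, u' @ v') \<in> word_cong X R"
proof (rule word_cong.trans)
  show "(u @ v, u' @ v) \<in> word_cong X R"
    using word_cong_append[OF assms(1), of "[]" v] word_cong_gwords[OF assms(2)] by simp
  show "(u' @ v, u' @ v') \<in> word_cong X R"
    using word_cong_append[OF assms(2), of u' "[]"] word_cong_gwords[OF assms(1)] by simp
qed

lemma word_class_eq_iff:
  assumes "u \<in> gwords X" "v \<in> gwords X"
  shows "word_class X R u = word_class X R v \<longleftrightarrow> (u, v) \<in> word_cong X R"
  unfolding word_class_def using equiv_word_cong assms by (rule eq_equiv_class_iff)

lemma presented_group_mult:
  assumes "u \<in> gwords X" "v \<in> gwords X"
  shows "word_class X R u \<otimes>\<^bsub>presented_group X R\<^esub> word_class X R v = word_class X R (u @ v)"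
proof -
  have 1: "word_class X R (u' @ v') = word_class X R (u @ v)"
    if "u' \<in> word_class X R u" "v' \<in> word_class X R v" for u' v'
  proof -
    have "(u @ v, u' @ v') \<in> word_cong X R"
      using that by (simp add: word_class_def word_cong_append2)
    then show ?thesis
      using word_cong_gwords[of "u @ v" "u' @ v'" X R] word_class_eq_iff[of "u @ v" X "u' @ v'" R]
      by simp
  qed
  have "u \<in> word_class X R u" "v \<in> word_class X R v"
    using assms by (auto simp: word_class_def intro: word_cong.refl)
  then have "(\<Union>u'\<in>word_class X R u. \<Union>v'\<in>word_class X R v. word_class X R (u' @ v'))
      = word_class X R (u @ v)"
    using 1 by blast
  then show ?thesis by (simp add: presented_group_def)
qed

lemma presented_group_carrier: "carrier (presented_group X R) = word_class X R ` gwords X"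
  by (auto simp: presented_group_def quotient_def word_class_def)

lemma presented_group_one: "\<one>\<^bsub>presented_group X R\<^esub> = word_class X R []"
  by (simp add: presented_group_def)

lemma word_cong_winv: "w \<in> gwords X \<Longrightarrow> (winv w @ w, []) \<in> word_cong X R"
proof (induction w)
  case Nil
  then show ?case by (simp add: winv_def word_cong.refl)
next
  case (Cons p w)
  obtain x b where p: "p = (x, b)" by (cases p)
  have "(winv w @ [(x, \<not> b), (x, \<not> \<not> b)] @ w, winv w @ w) \<in> word_cong X R"
    using Cons.prems p by (intro word_cong.cancel) simp_all
  moreover have "(winv w @ w, []) \<in> word_cong X R"
    using Cons by simp
  ultimately have "(winv w @ [(x, \<not> b), (x, \<not> \<not> b)] @ w, []) \<in> word_cong X R"
    by (rule word_cong.trans)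
  then show ?case using p by (simp add: winv_def)
qed

lemma group_presented_group: "group (presented_group X R)"
proof (rule groupI)
  fix U assume "U \<in> carrier (presented_group X R)"
  then obtain w where w: "w \<in> gwords X" "U = word_class X R w"
    by (auto simp: presented_group_carrier)
  show "\<exists>V\<in>carrier (presented_group X R).
      V \<otimes>\<^bsub>presented_group X R\<^esub> U = \<one>\<^bsub>presented_group X R\<^esub>"
    using w word_cong_winv[of w X R]
    by (intro bexI[of _ "word_class X R (winv w)"])
      (auto simp: presented_group_mult presented_group_one presented_group_carrier word_class_eq_iff)
qed (auto simp: presented_group_carrier presented_group_mult presented_group_one)


section \<open>The braid group on two strings of a closed surface\<close>

datatype braid_gen = Gen_a nat | Gen_b nat | Gen_sigma

definition braid_gens :: "nat \<Rightarrow> braid_gen set" where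
  "braid_gens g = Gen_a ` {1..g} \<union> Gen_b ` {1..g} \<union> {Gen_sigma}"

definition braid_rels :: "nat \<Rightarrow> (braid_gen gword \<times> braid_gen gword) set" where
  "braid_rels g =
    (let a = (\<lambda>i. gen (Gen_a i)); b = (\<lambda>i. gen (Gen_b i)); s = gen Gen_sigma; s' = winv s in
      {(wcomm (a i) (s' @ a i @ s'), []) | i. 1 \<le> i \<and> i \<le> g}
    \<union> {(wcomm (b i) (s' @ b i @ s'), []) | i. 1 \<le> i \<and> i \<le> g}
    \<union> {(wcomm (a i) (s' @ a j @ s), []) | i j. 1 \<le> j \<and> j < i \<and> i \<le> g}
    \<union> {(wcomm (a i) (s' @ b j @ s), []) | i j. 1 \<le> j \<and> j < i \<and> i \<le> g}
    \<union> {(wcomm (b i) (s' @ a j @ s), []) | i j. 1 \<le> j \<and> j < i \<and> i \<le> g}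
    \<union> {(wcomm (b i) (s' @ b j @ s), []) | i j. 1 \<le> j \<and> j < i \<and> i \<le> g}
    \<union> {(wcomm (a i) (s' @ b i @ s'), s @ s) | i. 1 \<le> i \<and> i \<le> g}
    \<union> {(concat (map (\<lambda>i. wcomm (a i) (winv (b i))) [1..<Suc g]), s @ s)})"

lemma braid_gens_simps [simp]:
  "Gen_a i \<in> braid_gens g \<longleftrightarrow> 1 \<le> i \<and> i \<le> g"
  "Gen_b i \<in> braid_gens g \<longleftrightarrow> 1 \<le> i \<and> i \<le> g"
  "Gen_sigma \<in> braid_gens g"
  by (auto simp: braid_gens_def)

lemma concat_in_gwords:
  "concat (map f js) \<in> gwords X \<longleftrightarrow> (\<forall>j\<in>set js. f j \<in> gwords X)"
  by (induction js) simp_all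

lemma braid_rels_words: "braid_rels g \<subseteq> gwords (braid_gens g) \<times> gwords (braid_gens g)"
  unfolding braid_rels_def Let_def
  by (intro Un_least; clarsimp simp: concat_in_gwords simp del: upt_Suc)

definition braid_group2 :: "nat \<Rightarrow> braid_gen gword set monoid" where
  "braid_group2 g = presented_group (braid_gens g) (braid_rels g)"

definition braid_sigma :: "nat \<Rightarrow> braid_gen gword set" where
  "braid_sigma g = word_class (braid_gens g) (braid_rels g) (gen Gen_sigma)"

text \<open>Members of \<^const>\<open>epi\<close> are total functions with arbitrary values outside the carrier;
  restricting to extensional ones makes each epimorphism count exactly once.\<close>

definition admissible_epis :: "nat \<Rightarrow> ('b, 'c) monoid_scheme \<Rightarrow> (braid_gen gword set \<Rightarrow> 'b) set" where
  "admissible_epis g G =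
    {\<phi> \<in> epi (braid_group2 g) G \<inter> extensional (carrier (braid_group2 g)).
       \<phi> (braid_sigma g) \<noteq> \<one>\<^bsub>G\<^esub>}"

definition num_admissible_epis :: "nat \<Rightarrow> ('b, 'c) monoid_scheme \<Rightarrow> nat" where
  "num_admissible_epis g G = card (admissible_epis g G)"


section \<open>Dihedral groups and the Jordan totient\<close>

datatype dihedral_gen = Gen_x | Gen_y

definition dihedral_rels :: "nat \<Rightarrow> (dihedral_gen gword \<times> dihedral_gen gword) set" where
  "dihedral_rels m =
    (let x = gen Gen_x; y = gen Gen_y in
      {(x @ x, []), (concat (replicate m y), []), (x @ y @ winv x, winv y)})"

lemma dihedral_rels_words: "dihedral_rels m \<subseteq> gwords UNIV \<times> gwords UNIV"
  by (auto simp: gwords_def)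

text \<open>The argument \<open>m\<close> is the order of the rotation \<open>y\<close>; the group has order \<open>2m\<close>.\<close>

definition dihedral_group :: "nat \<Rightarrow> dihedral_gen gword set monoid" where
  "dihedral_group m = presented_group UNIV (dihedral_rels m)"

definition jordan_totient :: "nat \<Rightarrow> nat \<Rightarrow> nat" where
  "jordan_totient k m =
    card {t \<in> {..<k} \<rightarrow>\<^sub>E carrier (integer_mod_group m).
      generate (integer_mod_group m) (t ` {..<k}) = carrier (integer_mod_group m)}"

end

theory Submission
  imports Defs
begin

text \<open>
By the universal property of the presentation, an admissible epimorphism is a tuple of elements
of the dihedral group that generates it, satisfies the braid relations, and has the image \<open>s\<close> of \<open>\<sigma>\<close>
different from \<open>1\<close>. The tuples are counted separately for each \<open>s\<close>, in an explicit model of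
the dihedral group.

Let \<open>m > 2\<close> and let \<open>s\<close> be one of the \<open>m\<close> reflections. Since \<open>s\<^sup>2 = 1\<close>, the relations make every handle
image commute with the conjugate by \<open>s\<close> of every handle image. Tuples of rotations satisfy this, as
well as the other relations, and together with \<open>s\<close> they generate the dihedral group if and only if
they generate the cyclic group of rotations (\<open>generate_dihedral_iff\<close>). This gives \<open>J\<^sub>2\<^sub>g(m)\<close> tuples for each \<open>s\<close>.
If some handle image is a reflection, the commutation conditions bound the exponent of the group of
rotations by 4 and leave only \<open>m = 4\<close> with all handle images in a Klein four-group
(\<open>admissible_tuples_reflection_cases\<close>). That group is abelian, stable under conjugation by \<open>s\<close>, and
a transversal of \<open>{1, s}\<close>, exactly like the group of rotations, so it yields another \<open>J\<^sub>2\<^sub>g(4)\<close> tuples: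
both families are instances of \<open>card_admissible_tuples_in_transversal\<close>.

If \<open>s\<close> is a rotation, then comparing two handles shows \<open>s\<^sup>2 = 1\<close> (\<open>dvd_two_c_of_two_pairs\<close>). Unless
it consists of rotations only, the whole tuple is then confined by the relations to a dihedral
subgroup with at most two rotations (\<open>admissible_tuples_rotation\<close>), so nothing generates when \<open>m > 2\<close>.

For \<open>m = 2\<close> all relations hold automatically. Each of the three \<open>s \<noteq> 1\<close> leaves \<open>4\<^sup>2\<^sup>g - 2\<^sup>2\<^sup>g\<close> tuples, namely
those not contained in \<open>{1, s}\<close>, and \<open>J\<^sub>2\<^sub>g(2) = 2\<^sup>2\<^sup>g - 1\<close>.
\<close>

section \<open>Epimorphisms from a presented group\<close>

fun word_eval :: "('b, 'c) monoid_scheme \<Rightarrow> ('a \<Rightarrow> 'b) \<Rightarrow> 'a gword \<Rightarrow> 'b" where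
  "word_eval G f [] = \<one>\<^bsub>G\<^esub>"
| "word_eval G f ((x, b) # w) = (if b then f x else inv\<^bsub>G\<^esub> f x) \<otimes>\<^bsub>G\<^esub> word_eval G f w"

definition satisfies_rels ::
    "('b, 'c) monoid_scheme \<Rightarrow> ('a gword \<times> 'a gword) set \<Rightarrow> ('a \<Rightarrow> 'b) \<Rightarrow> bool" where
  "satisfies_rels G R f \<longleftrightarrow> (\<forall>(l, r)\<in>R. word_eval G f l = word_eval G f r)"

context group
begin

lemma word_eval_closed [simp]:
  "f \<in> X \<rightarrow> carrier G \<Longrightarrow> w \<in> gwords X \<Longrightarrow> word_eval G f w \<in> carrier G"
  by (induction w) (auto simp: Pi_iff)

lemma word_eval_append:
  assumes f: "f \<in> X \<rightarrow> carrier G" and "u \<in> gwords X" and v: "v \<in> gwords X"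
  shows "word_eval G f (u @ v) = word_eval G f u \<otimes> word_eval G f v"
  using assms(2)
proof (induction u)
  case Nil
  then show ?case using f v by simp
next
  case (Cons p u)
  obtain x b where p: "p = (x, b)" by (cases p)
  have "f x \<in> carrier G" using Cons.prems f p by auto
  moreover have "word_eval G f u \<in> carrier G" "word_eval G f v \<in> carrier G"
    using Cons.prems f v by auto
  ultimately show ?case using Cons p by (simp add: m_assoc)
qed

lemma word_eval_gen [simp]: "f \<in> X \<rightarrow> carrier G \<Longrightarrow> x \<in> X \<Longrightarrow> word_eval G f (gen x) = f x"
  by (auto simp: gen_def Pi_iff)

lemma word_eval_winv:
  assumes f: "f \<in> X \<rightarrow> carrier G" and "w \<in> gwords X"
  shows "word_eval G f (winv w) = inv word_eval G f w"
  using assms(2)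
proof (induction w)
  case Nil
  then show ?case by (simp add: winv_def)
next
  case (Cons p w)
  obtain x b where p: "p = (x, b)" by (cases p)
  have x: "x \<in> X" "f x \<in> carrier G" and w: "w \<in> gwords X"
    using Cons.prems f p by auto
  have "winv (p # w) = winv w @ [(x, \<not> b)]"
    by (simp add: p winv_def)
  then have "word_eval G f (winv (p # w)) = inv word_eval G f w \<otimes> word_eval G f [(x, \<not> b)]"
    using Cons.IH w x by (simp add: word_eval_append[OF f])
  then show ?case
    using x f w by (simp add: p inv_mult_group)
qed

lemma word_eval_wcomm:
  assumes f: "f \<in> X \<rightarrow> carrier G" and "u \<in> gwords X" "v \<in> gwords X"
  shows "word_eval G f (wcomm u v) =
    word_eval G f u \<otimes> (word_eval G f v \<otimes> (inv word_eval G f u \<otimes> inv word_eval G f v))"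
  using assms by (simp add: wcomm_def word_eval_append[OF f] word_eval_winv[OF f])

lemma word_eval_word_cong:
  assumes f: "f \<in> X \<rightarrow> carrier G" and R: "satisfies_rels G R f"
    and "(u, v) \<in> word_cong X R"
  shows "word_eval G f u = word_eval G f v"
  using assms(3)
proof induction
  case (cancel u v x b)
  have "f x \<in> carrier G" using cancel f by auto
  moreover have "word_eval G f v \<in> carrier G" using cancel f by simp
  ultimately have "word_eval G f ([(x, b), (x, \<not> b)] @ v) = word_eval G f v"
    by (simp add: m_assoc[symmetric])
  then show ?case
    using cancel by (subst (1 2) word_eval_append[OF f]) auto
next
  case (rel l r u v)
  then show ?case
    using R by (auto simp: word_eval_append[OF f] satisfies_rels_def)
qed simp_all

lemma word_eval_image:
  assumes f: "f \<in> X \<rightarrow> carrier G"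
  shows "word_eval G f ` gwords X = generate G (f ` X)"
proof
  have "word_eval G f w \<in> generate G (f ` X)" if "w \<in> gwords X" for w
    using that
  proof (induction w)
    case Nil
    then show ?case by (simp add: generate.one)
  next
    case (Cons p w)
    then show ?case
      by (cases p) (auto intro: generate.eng generate.incl generate.inv)
  qed
  then show "word_eval G f ` gwords X \<subseteq> generate G (f ` X)" by auto
  show "generate G (f ` X) \<subseteq> word_eval G f ` gwords X"
  proof
    fix z assume "z \<in> generate G (f ` X)"
    then show "z \<in> word_eval G f ` gwords X"
    proof induction
      case one
      show ?case by (rule image_eqI[of _ _ "[]"]) auto
    next
      case (incl h)
      then obtain x where "x \<in> X" "h = f x" by auto
      then show ?case using f by (intro image_eqI[of _ _ "gen x"]) auto
    next
      case (inv h)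
      then obtain x where "x \<in> X" "h = f x" by auto
      then show ?case
        using f by (intro image_eqI[of _ _ "winv (gen x)"]) (auto simp: word_eval_winv[OF f])
    next
      case (eng h1 h2)
      then obtain u v where "u \<in> gwords X" "v \<in> gwords X"
        "h1 = word_eval G f u" "h2 = word_eval G f v" by auto
      then show ?case
        by (intro image_eqI[of _ _ "u @ v"]) (auto simp: word_eval_append[OF f])
    qed
  qed
qed

lemma hom_word_class:
  assumes \<phi>: "\<phi> \<in> hom (presented_group X R) G" and "w \<in> gwords X"
  shows "\<phi> (word_class X R w) = word_eval G (\<lambda>x\<in>X. \<phi> (word_class X R (gen x))) w"
proof -
  interpret P: group "presented_group X R" by (rule group_presented_group)
  interpret \<phi>: group_hom "presented_group X R" G \<phi>
    using \<phi> by unfold_locales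
  show ?thesis
    using assms(2)
  proof (induction w)
    case Nil
    then show ?case using \<phi>.hom_one by (simp add: presented_group_one)
  next
    case (Cons p w)
    obtain x b where p: "p = (x, b)" by (cases p)
    have x: "x \<in> X" and w: "w \<in> gwords X" using Cons.prems p by auto
    have xc: "word_class X R (gen x) \<in> carrier (presented_group X R)"
      using x by (simp add: presented_group_carrier)
    have inv: "inv\<^bsub>presented_group X R\<^esub> (word_class X R (gen x)) = word_class X R [(x, False)]"
    proof (rule P.inv_equality)
      have "(winv (gen x) @ gen x, []) \<in> word_cong X R"
        using x by (intro word_cong_winv) simp
      then show "word_class X R [(x, False)] \<otimes>\<^bsub>presented_group X R\<^esub> word_class X R (gen x)
          = \<one>\<^bsub>presented_group X R\<^esub>"
        using x by (simp add: presented_group_mult presented_group_one gen_def winv_def word_class_eq_iff)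
    qed (use x xc in \<open>auto simp: presented_group_carrier\<close>)
    have "word_class X R (p # w)
        = word_class X R [p] \<otimes>\<^bsub>presented_group X R\<^esub> word_class X R w"
      using p x w by (simp add: presented_group_mult)
    moreover have "\<phi> (word_class X R [p])
        = (if b then \<phi> (word_class X R (gen x)) else inv \<phi> (word_class X R (gen x)))"
      using p xc inv \<phi>.hom_inv[OF xc] by (simp add: gen_def)
    moreover have "word_class X R [p] \<in> carrier (presented_group X R)"
      "word_class X R w \<in> carrier (presented_group X R)"
      using p x w by (simp_all add: presented_group_carrier)
    ultimately show ?case
      using Cons.IH w p x \<phi>.hom_mult by simp
  qed
qed

lemma hom_generators_satisfy_rels:
  assumes "\<phi> \<in> hom (presented_group X R) G" and R: "R \<subseteq> gwords X \<times> gwords X"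
  shows "satisfies_rels G R (\<lambda>x\<in>X. \<phi> (word_class X R (gen x)))"
  unfolding satisfies_rels_def
proof safe
  fix l r assume lr: "(l, r) \<in> R"
  then have "l \<in> gwords X" "r \<in> gwords X" using R by auto
  moreover from this have "word_class X R l = word_class X R r"
    using word_cong.rel[OF lr, of X "[]" "[]"] by (simp add: word_class_eq_iff)
  ultimately show "word_eval G (\<lambda>x\<in>X. \<phi> (word_class X R (gen x))) l
      = word_eval G (\<lambda>x\<in>X. \<phi> (word_class X R (gen x))) r"
    using hom_word_class[OF assms(1)] by metis
qed

text \<open>The homomorphism evaluates a representative of each class; the choice does not matter because
evaluation is constant on classes.\<close>

lemma presented_group_universal:
  assumes f: "f \<in> X \<rightarrow>\<^sub>E carrier G" and R: "satisfies_rels G R f"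
  obtains \<phi> where "\<phi> \<in> hom (presented_group X R) G"
    "\<phi> \<in> extensional (carrier (presented_group X R))"
    "\<And>w. w \<in> gwords X \<Longrightarrow> \<phi> (word_class X R w) = word_eval G f w"
proof -
  define \<phi> where "\<phi> = (\<lambda>U\<in>carrier (presented_group X R). word_eval G f (SOME w. w \<in> U))"
  have fX: "f \<in> X \<rightarrow> carrier G" using f by auto
  have eval: "\<phi> (word_class X R w) = word_eval G f w" if w: "w \<in> gwords X" for w
  proof -
    have "w \<in> word_class X R w"
      using w by (simp add: word_class_def word_cong.refl)
    then have "(SOME v. v \<in> word_class X R w) \<in> word_class X R w" by (rule someI)
    then have "(w, SOME v. v \<in> word_class X R w) \<in> word_cong X R"
      by (simp add: word_class_def)
    then have "word_eval G f w = word_eval G f (SOME v. v \<in> word_class X R w)"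
      by (rule word_eval_word_cong[OF fX R])
    then show ?thesis
      using w by (simp add: \<phi>_def presented_group_carrier)
  qed
  have "\<phi> \<in> hom (presented_group X R) G"
    by (rule homI)
      (auto simp: presented_group_carrier presented_group_mult eval word_eval_append[OF fX]
        word_eval_closed[OF fX])
  then show ?thesis
    using that eval by (simp add: \<phi>_def)
qed

text \<open>A homomorphism out of a presented group is determined by the images of the generators, any tuple
satisfying the relations occurs, and its image is the subgroup generated by the tuple. So
counting epimorphisms is counting generating tuples that satisfy the relations. Extensionality on
both sides makes the correspondence one-to-one.\<close>

lemma bij_betw_presented_epis:
  assumes R: "R \<subseteq> gwords X \<times> gwords X"
  shows "bij_betw (\<lambda>\<phi>. \<lambda>x\<in>X. \<phi> (word_class X R (gen x)))
    (epi (presented_group X R) G \<inter> extensional (carrier (presented_group X R)))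
    {f \<in> X \<rightarrow>\<^sub>E carrier G. satisfies_rels G R f \<and> generate G (f ` X) = carrier G}"
    (is "bij_betw ?r ?E ?F")
proof (rule bij_betw_imageI)
  have img: "\<phi> ` carrier (presented_group X R) = generate G (f ` X)"
    if "f \<in> X \<rightarrow> carrier G" "\<And>w. w \<in> gwords X \<Longrightarrow> \<phi> (word_class X R w) = word_eval G f w" for \<phi> f
    using that by (simp add: presented_group_carrier image_image flip: word_eval_image)
  show "inj_on ?r ?E"
  proof (rule inj_onI)
    fix \<phi> \<psi> assume *: "\<phi> \<in> ?E" "\<psi> \<in> ?E" and eq: "?r \<phi> = ?r \<psi>"
    then have h: "\<phi> \<in> hom (presented_group X R) G" "\<psi> \<in> hom (presented_group X R) G"
      by (auto simp: epi_def)
    show "\<phi> = \<psi>"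
    proof (rule extensionalityI)
      fix U assume "U \<in> carrier (presented_group X R)"
      then obtain w where "w \<in> gwords X" "U = word_class X R w"
        by (auto simp: presented_group_carrier)
      then show "\<phi> U = \<psi> U"
        using hom_word_class[OF h(1)] hom_word_class[OF h(2)] eq by simp
    qed (use * in auto)
  qed
  show "?r ` ?E = ?F"
  proof
    show "?r ` ?E \<subseteq> ?F"
    proof
      fix f assume "f \<in> ?r ` ?E"
      then obtain \<phi> where h: "\<phi> \<in> hom (presented_group X R) G"
        and onto: "\<phi> ` carrier (presented_group X R) = carrier G" and f: "f = ?r \<phi>"
        by (auto simp: epi_def)
      have fE: "f \<in> X \<rightarrow>\<^sub>E carrier G"
        unfolding f using hom_in_carrier[OF h] by (auto simp: presented_group_carrier)
      then have "generate G (f ` X) = carrier G"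
        using img[OF _ hom_word_class[OF h, folded f]] onto by auto
      then show "f \<in> ?F"
        using fE hom_generators_satisfy_rels[OF h R] f by simp
    qed
    show "?F \<subseteq> ?r ` ?E"
    proof
      fix f assume "f \<in> ?F"
      then have f: "f \<in> X \<rightarrow>\<^sub>E carrier G" and rel: "satisfies_rels G R f"
        and gen: "generate G (f ` X) = carrier G" by auto
      obtain \<phi> where \<phi>: "\<phi> \<in> hom (presented_group X R) G"
        "\<phi> \<in> extensional (carrier (presented_group X R))"
        "\<And>w. w \<in> gwords X \<Longrightarrow> \<phi> (word_class X R w) = word_eval G f w"
        using presented_group_universal[OF f rel] by blast
      have fX: "f \<in> X \<rightarrow> carrier G" using f by auto
      have "\<phi> \<in> ?E"
        using \<phi> img[OF fX \<phi>(3)] gen by (simp add: epi_def)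
      moreover have "f = ?r \<phi>"
        using \<phi>(3) f word_eval_gen[OF fX] by (intro extensionalityI[of _ X]) (auto simp: PiE_iff)
      ultimately show "f \<in> ?r ` ?E" by blast
    qed
  qed
qed

end

section \<open>Admissible epimorphisms, fibred over the image of the half twist\<close>

definition admissible_tuples :: "nat \<Rightarrow> ('b, 'c) monoid_scheme \<Rightarrow> 'b \<Rightarrow> (braid_gen \<Rightarrow> 'b) set" where
  "admissible_tuples g G s = {f \<in> braid_gens g \<rightarrow>\<^sub>E carrier G. f Gen_sigma = s \<and>
     satisfies_rels G (braid_rels g) f \<and> generate G (f ` braid_gens g) = carrier G}"

lemma finite_braid_gens [simp]: "finite (braid_gens g)"
  by (simp add: braid_gens_def)

lemma num_admissible_epis_eq_sum:
  fixes G (structure)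
  assumes "group G" and fin: "finite (carrier G)"
  shows "num_admissible_epis g G = (\<Sum>s\<in>carrier G - {\<one>\<^bsub>G\<^esub>}. card (admissible_tuples g G s))"
proof -
  interpret group G by fact
  let ?r = "\<lambda>\<phi>. \<lambda>x\<in>braid_gens g. \<phi> (word_class (braid_gens g) (braid_rels g) (gen x))"
  have "bij_betw ?r (admissible_epis g G)
      (\<Union>s\<in>carrier G - {\<one>}. admissible_tuples g G s)"
  proof (rule bij_betw_subset[OF bij_betw_presented_epis[OF braid_rels_words[of g]]])
    show "admissible_epis g G \<subseteq> epi (presented_group (braid_gens g) (braid_rels g)) G
        \<inter> extensional (carrier (presented_group (braid_gens g) (braid_rels g)))"
      by (auto simp: admissible_epis_def braid_group2_def)
    have "?r ` admissible_epis g G = {f \<in> ?r ` (epi (presented_group (braid_gens g) (braid_rels g)) G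
        \<inter> extensional (carrier (presented_group (braid_gens g) (braid_rels g)))). f Gen_sigma \<noteq> \<one>}"
      by (auto simp: admissible_epis_def braid_group2_def braid_sigma_def)
    also have "\<dots> = (\<Union>s\<in>carrier G - {\<one>}. admissible_tuples g G s)"
      using bij_betw_imp_surj_on[OF bij_betw_presented_epis[OF braid_rels_words[of g]]]
      by (auto simp: admissible_tuples_def PiE_iff)
    finally show "?r ` admissible_epis g G = (\<Union>s\<in>carrier G - {\<one>}. admissible_tuples g G s)" .
  qed
  then have "num_admissible_epis g G = card (\<Union>s\<in>carrier G - {\<one>}. admissible_tuples g G s)"
    unfolding num_admissible_epis_def by (rule bij_betw_same_card)
  also have "\<dots> = (\<Sum>s\<in>carrier G - {\<one>}. card (admissible_tuples g G s))"
  proof (rule card_UN_disjoint)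
    have "finite (braid_gens g \<rightarrow>\<^sub>E carrier G)" using fin by (simp add: finite_PiE)
    then show "\<forall>s\<in>carrier G - {\<one>}. finite (admissible_tuples g G s)"
      by (auto simp: admissible_tuples_def)
  qed (use fin in \<open>auto simp: admissible_tuples_def\<close>)
  finally show ?thesis .
qed

lemma compose_iso_admissible_epi:
  assumes "group G'" and \<psi>: "\<psi> \<in> iso G G'" and G: "group G" and \<phi>: "\<phi> \<in> admissible_epis g G"
  shows "compose (carrier (braid_group2 g)) \<psi> \<phi> \<in> admissible_epis g G'"
proof -
  interpret G: group G by fact
  interpret \<psi>: group_hom G G' \<psi>
    using assms by (auto simp: group_hom_def group_hom_axioms_def iso_def)
  let ?B = "braid_group2 g"
  have sig: "braid_sigma g \<in> carrier ?B"
    by (auto simp: braid_sigma_def braid_group2_def presented_group_carrier)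
  have hom: "\<phi> \<in> hom ?B G" and onto: "\<phi> ` carrier ?B = carrier G"
    and ne: "\<phi> (braid_sigma g) \<noteq> \<one>\<^bsub>G\<^esub>"
    using \<phi> by (auto simp: admissible_epis_def epi_def)
  have inj: "inj_on \<psi> (carrier G)" and surj: "\<psi> ` carrier G = carrier G'"
    using \<psi> by (auto simp: iso_def bij_betw_def)
  interpret B: group ?B unfolding braid_group2_def by (rule group_presented_group)
  have "compose (carrier ?B) \<psi> \<phi> \<in> hom ?B G'"
    using B.hom_compose[OF hom \<psi>.homh] by simp
  moreover have "compose (carrier ?B) \<psi> \<phi> ` carrier ?B = carrier G'"
    using onto surj by (metis compose_def image_cong image_image restrict_apply')
  moreover have "\<psi> (\<phi> (braid_sigma g)) \<noteq> \<psi> \<one>\<^bsub>G\<^esub>"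
    using inj_on_eq_iff[OF inj hom_in_carrier[OF hom sig] G.one_closed] ne by blast
  ultimately show ?thesis
    using sig by (simp add: admissible_epis_def epi_def compose_def)
qed

lemma admissible_epis_funcset:
  "\<phi> \<in> admissible_epis g G \<Longrightarrow> \<phi> \<in> carrier (braid_group2 g) \<rightarrow>\<^sub>E carrier G"
  by (auto simp: admissible_epis_def epi_def hom_def PiE_iff)

text \<open>The number of admissible epimorphisms is an isomorphism invariant, which allows replacing the
presented dihedral group by an explicit model.\<close>

lemma num_admissible_epis_iso:
  assumes "group G" "group G'" and \<psi>: "\<psi> \<in> iso G G'"
  shows "num_admissible_epis g G = num_admissible_epis g G'"
proof -
  let ?B = "carrier (braid_group2 g)" and ?\<psi>' = "inv_into (carrier G) \<psi>"
  have \<psi>': "?\<psi>' \<in> iso G' G"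
    using group.iso_set_sym[OF assms(1) \<psi>] .
  have bij: "bij_betw \<psi> (carrier G) (carrier G')"
    using \<psi> by (simp add: iso_def)
  have "bij_betw (compose ?B \<psi>) (admissible_epis g G) (admissible_epis g G')"
  proof (rule bij_betw_byWitness[where f' = "compose ?B ?\<psi>'"])
    show "\<forall>\<phi>\<in>admissible_epis g G. compose ?B ?\<psi>' (compose ?B \<psi> \<phi>) = \<phi>"
      using bij_betw_inv_into_left[OF bij]
      by (auto simp: compose_def fun_eq_iff PiE_iff extensional_def dest!: admissible_epis_funcset)
    show "\<forall>\<phi>\<in>admissible_epis g G'. compose ?B \<psi> (compose ?B ?\<psi>' \<phi>) = \<phi>"
      using bij_betw_inv_into_right[OF bij]
      by (auto simp: compose_def fun_eq_iff PiE_iff extensional_def dest!: admissible_epis_funcset)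
  qed (use compose_iso_admissible_epi assms \<psi>' in blast)+
  then show ?thesis
    unfolding num_admissible_epis_def by (rule bij_betw_same_card)
qed

section \<open>The dihedral group as signed residues\<close>

text \<open>The pair \<open>(k, e)\<close> stands for \<open>y\<^sup>k\<close> if \<open>e\<close> is false and for \<open>y\<^sup>k x\<close> if \<open>e\<close> is true; so \<open>e\<close> tells reflections
from rotations, and the sign in the product is \<open>x y x\<^sup>-\<^sup>1 = y\<^sup>-\<^sup>1\<close>.\<close>

definition dihedral_model :: "nat \<Rightarrow> (int \<times> bool) monoid" where
  "dihedral_model m = \<lparr>carrier = {0..<int m} \<times> UNIV,
     monoid.mult = (\<lambda>(k, e) (l, f). ((if e then k - l else k + l) mod int m, e \<noteq> f)),
     one = (0, False)\<rparr>"

lemma dihedral_model_simps [simp]: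
  "(k, e) \<in> carrier (dihedral_model m) \<longleftrightarrow> 0 \<le> k \<and> k < int m"
  "(k, e) \<otimes>\<^bsub>dihedral_model m\<^esub> (l, f) = ((if e then k - l else k + l) mod int m, e \<noteq> f)"
  "\<one>\<^bsub>dihedral_model m\<^esub> = (0, False)"
  by (auto simp: dihedral_model_def)

lemma finite_dihedral_model [simp]: "finite (carrier (dihedral_model m))"
  by (simp add: dihedral_model_def)

lemma group_dihedral_model:
  assumes "m > 0" shows "group (dihedral_model m)"
proof (rule groupI)
  fix u v w assume "u \<in> carrier (dihedral_model m)" "v \<in> carrier (dihedral_model m)"
    "w \<in> carrier (dihedral_model m)"
  then show "u \<otimes>\<^bsub>dihedral_model m\<^esub> v \<otimes>\<^bsub>dihedral_model m\<^esub> w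
      = u \<otimes>\<^bsub>dihedral_model m\<^esub> (v \<otimes>\<^bsub>dihedral_model m\<^esub> w)"
    by (cases u; cases v; cases w) (auto simp: mod_simps algebra_simps)
next
  fix u assume u: "u \<in> carrier (dihedral_model m)"
  then show "\<one>\<^bsub>dihedral_model m\<^esub> \<otimes>\<^bsub>dihedral_model m\<^esub> u = u"
    by (cases u) auto
  obtain k e where ke: "u = (k, e)" by (cases u)
  show "\<exists>v\<in>carrier (dihedral_model m). v \<otimes>\<^bsub>dihedral_model m\<^esub> u = \<one>\<^bsub>dihedral_model m\<^esub>"
    using u assms by (intro bexI[of _ "(if e then k else - k mod int m, e)"]) (auto simp: ke mod_simps)
qed (use assms in auto)

lemma inv_dihedral_model:
  assumes "m > 0" "0 \<le> k" "k < int m"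
  shows "inv\<^bsub>dihedral_model m\<^esub> (k, e) = (if e then k else - k mod int m, e)"
  by (rule group.inv_equality[OF group_dihedral_model]) (use assms in \<open>auto simp: mod_simps\<close>)

text \<open>Mapping \<open>x\<close> to \<open>(0, True)\<close> and \<open>y\<close> to \<open>(1, False)\<close> respects the relations, hence extends to
a homomorphism onto the model. It is injective because every word can be rewritten to a
normal form \<open>y\<^sup>n x\<^sup>e\<close> with \<open>n < m\<close>, and distinct normal forms have distinct images.\<close>

lemma dihedral_group_iso_model:
  assumes "m \<ge> 2"
  shows "\<exists>\<psi>. \<psi> \<in> iso (dihedral_group m) (dihedral_model m)"
proof -
  let ?D = "dihedral_model m" and ?P = "dihedral_group m"
  have m0: "m > 0" using assms by simp
  interpret D: group ?D by (rule group_dihedral_model[OF m0])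
  interpret P: group ?P unfolding dihedral_group_def by (rule group_presented_group)
  let ?c = "word_class UNIV (dihedral_rels m)"
  have UNIV_words [simp]: "w \<in> gwords UNIV" for w :: "dihedral_gen gword"
    by (simp add: gwords_def)
  define f where "f = (\<lambda>z. case z of Gen_x \<Rightarrow> (0::int, True) | Gen_y \<Rightarrow> (1, False))"
  have f: "f \<in> UNIV \<rightarrow>\<^sub>E carrier ?D"
    using assms by (auto simp: f_def split: dihedral_gen.split)
  have fU: "f \<in> UNIV \<rightarrow> carrier ?D" using f by auto
  note ev = D.word_eval_append[OF fU] D.word_eval_winv[OF fU] D.word_eval_gen[OF fU]
  have y_pow: "word_eval ?D f (concat (replicate n (gen Gen_y))) = (int n mod int m, False)" for n
    by (induction n) (simp_all add: ev mod_simps, simp add: f_def mod_simps)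
  have "satisfies_rels ?D (dihedral_rels m) f"
    using assms y_pow
    by (auto simp: satisfies_rels_def dihedral_rels_def Let_def ev inv_dihedral_model)
       (auto simp: f_def inv_dihedral_model)
  then obtain \<psi> where \<psi>: "\<psi> \<in> hom (presented_group UNIV (dihedral_rels m)) ?D"
    "\<And>w. \<psi> (?c w) = word_eval ?D f w"
    using D.presented_group_universal[OF f] by (metis UNIV_words)
  define X Y where "X = ?c (gen Gen_x)" and "Y = ?c (gen Gen_y)"
  have c_mult: "?c (u @ v) = ?c u \<otimes>\<^bsub>?P\<^esub> ?c v" for u v
    by (simp add: dihedral_group_def presented_group_mult)
  have c_in: "?c w \<in> carrier ?P" for w
    by (simp add: dihedral_group_def presented_group_carrier)
  have c_one: "?c [] = \<one>\<^bsub>?P\<^esub>"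
    by (simp add: dihedral_group_def presented_group_one)
  have c_rel: "?c l = ?c r" if "(l, r) \<in> dihedral_rels m" for l r
    using word_cong.rel[OF that, of UNIV "[]" "[]"] by (simp add: word_class_eq_iff)
  have c_winv: "?c (winv w) = inv\<^bsub>?P\<^esub> ?c w" for w
    using word_cong_winv[of w UNIV "dihedral_rels m"]
    by (intro P.inv_equality[symmetric]) (auto simp: c_in word_class_eq_iff simp flip: c_mult c_one)
  have XY [simp]: "X \<in> carrier ?P" "Y \<in> carrier ?P"
    by (simp_all add: X_def Y_def c_in)
  have XX: "X \<otimes>\<^bsub>?P\<^esub> X = \<one>\<^bsub>?P\<^esub>"
    unfolding X_def c_mult[symmetric] c_one[symmetric]
    by (rule c_rel) (simp add: dihedral_rels_def Let_def)
  have Y_pow: "?c (concat (replicate n (gen Gen_y))) = Y [^]\<^bsub>?P\<^esub> n" for n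
  proof (induction n)
    case (Suc n)
    then show ?case
      using P.nat_pow_Suc2[OF XY(2), of n] by (simp add: c_mult flip: Y_def)
  qed (simp add: c_one)
  have "(concat (replicate m (gen Gen_y)), []) \<in> dihedral_rels m"
    by (simp add: dihedral_rels_def Let_def)
  then have Ym: "Y [^]\<^bsub>?P\<^esub> m = \<one>\<^bsub>?P\<^esub>"
    using c_rel c_one Y_pow by metis
  have "?c (gen Gen_x @ gen Gen_y @ winv (gen Gen_x)) = ?c (winv (gen Gen_y))"
    by (rule c_rel) (simp add: dihedral_rels_def Let_def)
  then have XYX: "X \<otimes>\<^bsub>?P\<^esub> (Y \<otimes>\<^bsub>?P\<^esub> inv\<^bsub>?P\<^esub> X) = inv\<^bsub>?P\<^esub> Y"
    by (simp add: c_mult c_winv X_def Y_def)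
  have invX: "inv\<^bsub>?P\<^esub> X = X"
    using XX by (simp add: P.inv_equality)
  have invY: "inv\<^bsub>?P\<^esub> Y = Y [^]\<^bsub>?P\<^esub> (m - 1)"
  proof (rule P.inv_equality)
    have "Y [^]\<^bsub>?P\<^esub> (m - 1) \<otimes>\<^bsub>?P\<^esub> Y = Y [^]\<^bsub>?P\<^esub> Suc (m - 1)"
      by simp
    then show "Y [^]\<^bsub>?P\<^esub> (m - 1) \<otimes>\<^bsub>?P\<^esub> Y = \<one>\<^bsub>?P\<^esub>"
      using Ym m0 by simp
  qed simp_all
  have XY_comm: "X \<otimes>\<^bsub>?P\<^esub> Y = Y [^]\<^bsub>?P\<^esub> (m - 1) \<otimes>\<^bsub>?P\<^esub> X"
  proof -
    have "X \<otimes>\<^bsub>?P\<^esub> (Y \<otimes>\<^bsub>?P\<^esub> X) = Y [^]\<^bsub>?P\<^esub> (m - 1)"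
      using XYX invX invY by simp
    then have "X \<otimes>\<^bsub>?P\<^esub> (Y \<otimes>\<^bsub>?P\<^esub> X) \<otimes>\<^bsub>?P\<^esub> X = Y [^]\<^bsub>?P\<^esub> (m - 1) \<otimes>\<^bsub>?P\<^esub> X"
      by simp
    then show ?thesis by (simp add: P.m_assoc XX)
  qed
  have X_pow: "X \<otimes>\<^bsub>?P\<^esub> Y [^]\<^bsub>?P\<^esub> n = Y [^]\<^bsub>?P\<^esub> ((m - 1) * n) \<otimes>\<^bsub>?P\<^esub> X" for n
  proof (induction n)
    case (Suc n)
    have "X \<otimes>\<^bsub>?P\<^esub> Y [^]\<^bsub>?P\<^esub> Suc n = Y [^]\<^bsub>?P\<^esub> ((m - 1) * n) \<otimes>\<^bsub>?P\<^esub> (X \<otimes>\<^bsub>?P\<^esub> Y)"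
      using Suc by (simp flip: P.m_assoc)
    also have "\<dots> = Y [^]\<^bsub>?P\<^esub> ((m - 1) * n + (m - 1)) \<otimes>\<^bsub>?P\<^esub> X"
      by (simp add: XY_comm P.nat_pow_mult flip: P.m_assoc)
    finally show ?case by (simp add: add.commute)
  qed simp
  \<comment> \<open>The normal forms; letters act on them from the left, so every word reaches one.\<close>
  define nf where "nf n e = Y [^]\<^bsub>?P\<^esub> n \<otimes>\<^bsub>?P\<^esub> (if e then X else \<one>\<^bsub>?P\<^esub>)" for n :: nat and e
  have nf_X: "X \<otimes>\<^bsub>?P\<^esub> nf n e = nf ((m - 1) * n) (\<not> e)" for n e
    by (simp add: nf_def X_pow P.m_assoc XX flip: P.m_assoc[of X])
  have nf_Y: "Y [^]\<^bsub>?P\<^esub> k \<otimes>\<^bsub>?P\<^esub> nf n e = nf (k + n) e" for k n e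
    by (simp add: nf_def P.nat_pow_mult flip: P.m_assoc)
  have nf_exists: "\<exists>n e. ?c w = nf n e" for w
  proof (induction w)
    case Nil
    have "?c [] = nf 0 False" by (simp add: nf_def c_one)
    then show ?case by blast
  next
    case (Cons p w)
    obtain z b where p: "p = (z, b)" by (cases p)
    obtain n e where w: "?c w = nf n e" using Cons by blast
    have "?c (p # w) = ?c [p] \<otimes>\<^bsub>?P\<^esub> nf n e"
      using c_mult[of "[p]" w] w by simp
    moreover have "?c [p] = (case z of Gen_x \<Rightarrow> X
        | Gen_y \<Rightarrow> if b then Y else Y [^]\<^bsub>?P\<^esub> (m - 1))"
      using c_winv[of "gen z"] invX invY XY
      by (auto simp: p X_def Y_def gen_def winv_def c_in split: dihedral_gen.split)
    ultimately show ?case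
      using nf_X nf_Y nf_Y[of "Suc 0"] by (cases z; cases b) (simp_all, blast+)
  qed
  have nf_mod: "nf n e = nf (n mod m) e" for n e
  proof -
    have "Y [^]\<^bsub>?P\<^esub> n = Y [^]\<^bsub>?P\<^esub> (m * (n div m)) \<otimes>\<^bsub>?P\<^esub> Y [^]\<^bsub>?P\<^esub> (n mod m)"
      by (simp add: P.nat_pow_mult)
    also have "Y [^]\<^bsub>?P\<^esub> (m * (n div m)) = \<one>\<^bsub>?P\<^esub>"
      using Ym P.nat_pow_pow[of Y m "n div m"] by simp
    finally show ?thesis by (simp add: nf_def)
  qed
  have nf_class: "nf n e = ?c (concat (replicate n (gen Gen_y)) @ (if e then gen Gen_x else []))" for n e
    by (simp add: nf_def c_mult Y_pow c_one X_def)
  have \<psi>_nf: "\<psi> (nf n e) = (int n mod int m, e)" for n e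
    by (simp add: nf_class \<psi>(2) ev y_pow) (simp add: f_def)
  have "inj_on \<psi> (carrier ?P)"
  proof (rule inj_onI)
    fix U V assume "U \<in> carrier ?P" "V \<in> carrier ?P" and eq: "\<psi> U = \<psi> V"
    then obtain u v where "U = ?c u" "V = ?c v"
      by (auto simp: dihedral_group_def presented_group_carrier)
    then obtain n e n' e' where UV: "U = nf n e" "V = nf n' e'"
      using nf_exists[of u] nf_exists[of v] by blast
    then have "n mod m = n' mod m" "e = e'"
      using eq by (simp_all add: \<psi>_nf flip: of_nat_mod)
    moreover have "U = nf (n mod m) e" "V = nf (n' mod m) e'"
      unfolding UV by (rule nf_mod)+
    ultimately show "U = V" by simp
  qed
  moreover have "\<psi> ` carrier ?P = carrier ?D"
  proof
    show "\<psi> ` carrier ?P \<subseteq> carrier ?D"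
      using hom_carrier[OF \<psi>(1)] by (simp add: dihedral_group_def)
    show "carrier ?D \<subseteq> \<psi> ` carrier ?P"
    proof
      fix u assume u: "u \<in> carrier ?D"
      obtain k e where "u = (k, e)" by (cases u)
      then have "u = \<psi> (nf (nat k) e)" using u by (simp add: \<psi>_nf)
      moreover have "nf (nat k) e \<in> carrier ?P" by (simp add: nf_class c_in)
      ultimately show "u \<in> \<psi> ` carrier ?P" by blast
    qed
  qed
  ultimately have "\<psi> \<in> iso ?P ?D"
    using \<psi>(1) by (simp add: iso_def bij_betw_def dihedral_group_def)
  then show ?thesis by blast
qed

section \<open>The braid relations in an arbitrary group\<close>

text \<open>The generators \<open>a\<^sub>i\<close> and \<open>b\<^sub>i\<close> come from the handles of the surface. Apart from the two
relations with right-hand side \<open>\<sigma>\<^sup>2\<close>, the relations treat \<open>a\<^sub>i\<close> and \<open>b\<^sub>i\<close> alike and depend only on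
the order of the handle indices.\<close>

definition handles :: "nat \<Rightarrow> braid_gen set" where
  "handles g = Gen_a ` {1..g} \<union> Gen_b ` {1..g}"

fun handle_index :: "braid_gen \<Rightarrow> nat" where
  "handle_index (Gen_a i) = i"
| "handle_index (Gen_b i) = i"
| "handle_index Gen_sigma = 0"

lemma braid_gens_eq: "braid_gens g = insert Gen_sigma (handles g)"
  by (auto simp: braid_gens_def handles_def)

lemma sigma_notin_handles [simp]: "Gen_sigma \<notin> handles g"
  by (auto simp: handles_def)

lemma in_handles_iff [simp]:
  "Gen_a i \<in> handles g \<longleftrightarrow> 1 \<le> i \<and> i \<le> g"
  "Gen_b i \<in> handles g \<longleftrightarrow> 1 \<le> i \<and> i \<le> g"
  by (auto simp: handles_def)

lemma finite_handles [simp]: "finite (handles g)"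
  by (simp add: handles_def)

lemma card_handles: "card (handles g) = 2 * g"
proof -
  have "card (handles g) = card (Gen_a ` {1..g}) + card (Gen_b ` {1..g})"
    unfolding handles_def by (intro card_Un_disjoint) auto
  also have "\<dots> = 2 * g"
    by (simp add: card_image inj_on_def)
  finally show ?thesis .
qed

lemma handle_pair_cases:
  assumes "h \<in> handles g" "h' \<in> handles g"
  obtains "handle_index h' < handle_index h" | "handle_index h < handle_index h'" | "h = h'"
    | i where "1 \<le> i" "i \<le> g" "h = Gen_a i" "h' = Gen_b i"
    | i where "1 \<le> i" "i \<le> g" "h = Gen_b i" "h' = Gen_a i"
  using assms
  by (cases h; cases h'; cases "handle_index h" "handle_index h'" rule: linorder_cases) auto

lemma handles_ball:
  "(\<forall>h\<in>handles g. P h) \<longleftrightarrow> (\<forall>i. 1 \<le> i \<and> i \<le> g \<longrightarrow> P (Gen_a i) \<and> P (Gen_b i))"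
  by (auto simp: handles_def)

context group
begin

lemma commutator_eq_one_iff:
  assumes "u \<in> carrier G" "v \<in> carrier G"
  shows "u \<otimes> (v \<otimes> (inv u \<otimes> inv v)) = \<one> \<longleftrightarrow> u \<otimes> v = v \<otimes> u"
proof -
  have "u \<otimes> (v \<otimes> (inv u \<otimes> inv v)) = u \<otimes> v \<otimes> inv (v \<otimes> u)"
    using assms by (simp add: inv_mult_group m_assoc)
  then show ?thesis
    using assms by (metis inv_closed inv_equality inv_inv m_closed r_inv)
qed

text \<open>All arguments below treat the relations uniformly in the handle generators. This brings them into
that form: six of the eight families become two commutation conditions on pairs of handle
generators.\<close>

lemma satisfies_braid_rels_iff:
  assumes f: "f \<in> braid_gens g \<rightarrow> carrier G" and s: "s = f Gen_sigma"
  shows "satisfies_rels G (braid_rels g) f \<longleftrightarrow>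
    (\<forall>h\<in>handles g. f h \<otimes> (inv s \<otimes> f h \<otimes> inv s) = inv s \<otimes> f h \<otimes> inv s \<otimes> f h) \<and>
    (\<forall>h\<in>handles g. \<forall>h'\<in>handles g. handle_index h' < handle_index h \<longrightarrow>
      f h \<otimes> (inv s \<otimes> f h' \<otimes> s) = inv s \<otimes> f h' \<otimes> s \<otimes> f h) \<and>
    (\<forall>i. 1 \<le> i \<and> i \<le> g \<longrightarrow>
      f (Gen_a i) \<otimes> (inv s \<otimes> f (Gen_b i) \<otimes> inv s \<otimes>
        (inv f (Gen_a i) \<otimes> inv (inv s \<otimes> f (Gen_b i) \<otimes> inv s))) = s \<otimes> s) \<and>
    word_eval G f (concat (map (\<lambda>i. wcomm (gen (Gen_a i)) (winv (gen (Gen_b i)))) [1..<Suc g])) = s \<otimes> s"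
    (is "_ \<longleftrightarrow> ?R")
proof -
  have fc: "f h \<in> carrier G" if "h \<in> braid_gens g" for h using f that by auto
  have sc: "s \<in> carrier G" using fc s by simp
  note ev = word_eval_append[OF f] word_eval_winv[OF f] word_eval_gen[OF f] word_eval_wcomm[OF f]
  have 1: "word_eval G f (wcomm (gen h) (winv (gen Gen_sigma) @ gen h' @ winv (gen Gen_sigma))) = \<one>
      \<longleftrightarrow> f h \<otimes> (inv s \<otimes> f h' \<otimes> inv s) = inv s \<otimes> f h' \<otimes> inv s \<otimes> f h"
    if "h \<in> braid_gens g" "h' \<in> braid_gens g" for h h'
    using that fc sc by (simp add: ev commutator_eq_one_iff flip: s) (simp add: m_assoc)
  have 2: "word_eval G f (wcomm (gen h) (winv (gen Gen_sigma) @ gen h' @ gen Gen_sigma)) = \<one>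
      \<longleftrightarrow> f h \<otimes> (inv s \<otimes> f h' \<otimes> s) = inv s \<otimes> f h' \<otimes> s \<otimes> f h"
    if "h \<in> braid_gens g" "h' \<in> braid_gens g" for h h'
    using that fc sc by (simp add: ev commutator_eq_one_iff flip: s) (simp add: m_assoc)
  have 3: "word_eval G f (wcomm (gen h) (winv (gen Gen_sigma) @ gen h' @ winv (gen Gen_sigma)))
      = f h \<otimes> (inv s \<otimes> f h' \<otimes> inv s \<otimes> (inv f h \<otimes> inv (inv s \<otimes> f h' \<otimes> inv s)))"
    if "h \<in> braid_gens g" "h' \<in> braid_gens g" for h h'
    using that fc sc by (simp add: ev m_assoc flip: s)
  have 4: "word_eval G f (gen Gen_sigma @ gen Gen_sigma) = s \<otimes> s"
    using s by (simp add: ev)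
  have R1: "(\<forall>(l, r)\<in>{(F i, r0) | i. P i}. Q l r) \<longleftrightarrow> (\<forall>i. P i \<longrightarrow> Q (F i) r0)"
    for F :: "nat \<Rightarrow> braid_gen gword" and r0 :: "braid_gen gword" and P Q
    by auto
  have R2: "(\<forall>(l, r)\<in>{(F i j, r0) | i j. P i j}. Q l r) \<longleftrightarrow> (\<forall>i j. P i j \<longrightarrow> Q (F i j) r0)"
    for F :: "nat \<Rightarrow> nat \<Rightarrow> braid_gen gword" and r0 :: "braid_gen gword" and P Q
    by auto
  have R3: "(\<forall>(l, r)\<in>{(l0, r0)}. Q l r) \<longleftrightarrow> Q l0 r0" for l0 r0 :: "braid_gen gword" and Q
    by simp
  have "satisfies_rels G (braid_rels g) f \<longleftrightarrow>
    (\<forall>i. 1 \<le> i \<and> i \<le> g \<longrightarrow> word_eval G f (wcomm (gen (Gen_a i))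
        (winv (gen Gen_sigma) @ gen (Gen_a i) @ winv (gen Gen_sigma))) = \<one>) \<and>
    (\<forall>i. 1 \<le> i \<and> i \<le> g \<longrightarrow> word_eval G f (wcomm (gen (Gen_b i))
        (winv (gen Gen_sigma) @ gen (Gen_b i) @ winv (gen Gen_sigma))) = \<one>) \<and>
    (\<forall>i j. 1 \<le> j \<and> j < i \<and> i \<le> g \<longrightarrow> word_eval G f (wcomm (gen (Gen_a i))
        (winv (gen Gen_sigma) @ gen (Gen_a j) @ gen Gen_sigma)) = \<one>) \<and>
    (\<forall>i j. 1 \<le> j \<and> j < i \<and> i \<le> g \<longrightarrow> word_eval G f (wcomm (gen (Gen_a i))
        (winv (gen Gen_sigma) @ gen (Gen_b j) @ gen Gen_sigma)) = \<one>) \<and>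
    (\<forall>i j. 1 \<le> j \<and> j < i \<and> i \<le> g \<longrightarrow> word_eval G f (wcomm (gen (Gen_b i))
        (winv (gen Gen_sigma) @ gen (Gen_a j) @ gen Gen_sigma)) = \<one>) \<and>
    (\<forall>i j. 1 \<le> j \<and> j < i \<and> i \<le> g \<longrightarrow> word_eval G f (wcomm (gen (Gen_b i))
        (winv (gen Gen_sigma) @ gen (Gen_b j) @ gen Gen_sigma)) = \<one>) \<and>
    (\<forall>i. 1 \<le> i \<and> i \<le> g \<longrightarrow> word_eval G f (wcomm (gen (Gen_a i))
        (winv (gen Gen_sigma) @ gen (Gen_b i) @ winv (gen Gen_sigma))) = s \<otimes> s) \<and>
    word_eval G f (concat (map (\<lambda>i. wcomm (gen (Gen_a i)) (winv (gen (Gen_b i)))) [1..<Suc g])) = s \<otimes> s"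
    (is "_ \<longleftrightarrow> ?E")
    unfolding satisfies_rels_def braid_rels_def Let_def ball_Un 4[symmetric]
    unfolding R1 R2 R3 word_eval.simps(1) conj_assoc ..
  also have "?E \<longleftrightarrow> ?R"
  proof -
    let ?w = "\<lambda>h h'. word_eval G f (wcomm (gen h) (winv (gen Gen_sigma) @ gen h' @ winv (gen Gen_sigma)))"
    let ?v = "\<lambda>h h'. word_eval G f (wcomm (gen h) (winv (gen Gen_sigma) @ gen h' @ gen Gen_sigma))"
    have E1: "(\<forall>h\<in>handles g. f h \<otimes> (inv s \<otimes> f h \<otimes> inv s) = inv s \<otimes> f h \<otimes> inv s \<otimes> f h)
        \<longleftrightarrow> (\<forall>h\<in>handles g. ?w h h = \<one>)"
      by (simp add: 1 braid_gens_eq)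
    have E2: "(\<forall>h\<in>handles g. \<forall>h'\<in>handles g. handle_index h' < handle_index h \<longrightarrow>
        f h \<otimes> (inv s \<otimes> f h' \<otimes> s) = inv s \<otimes> f h' \<otimes> s \<otimes> f h)
        \<longleftrightarrow> (\<forall>h\<in>handles g. \<forall>h'\<in>handles g. handle_index h' < handle_index h \<longrightarrow> ?v h h' = \<one>)"
      by (simp add: 2 braid_gens_eq)
    have E3: "(\<forall>i. 1 \<le> i \<and> i \<le> g \<longrightarrow>
      f (Gen_a i) \<otimes> (inv s \<otimes> f (Gen_b i) \<otimes> inv s \<otimes>
        (inv f (Gen_a i) \<otimes> inv (inv s \<otimes> f (Gen_b i) \<otimes> inv s))) = s \<otimes> s)
      \<longleftrightarrow> (\<forall>i. 1 \<le> i \<and> i \<le> g \<longrightarrow> ?w (Gen_a i) (Gen_b i) = s \<otimes> s)"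
      by (simp add: 3)
    have F1: "(\<forall>h\<in>handles g. P h) \<longleftrightarrow> (\<forall>i. 1 \<le> i \<and> i \<le> g \<longrightarrow> P (Gen_a i)) \<and>
       (\<forall>i. 1 \<le> i \<and> i \<le> g \<longrightarrow> P (Gen_b i))" for P
      unfolding handles_ball by blast
    have F2: "(\<forall>h\<in>handles g. \<forall>h'\<in>handles g. handle_index h' < handle_index h \<longrightarrow> P h h') \<longleftrightarrow>
       (\<forall>i j. 1 \<le> j \<and> j < i \<and> i \<le> g \<longrightarrow> P (Gen_a i) (Gen_a j)) \<and>
       (\<forall>i j. 1 \<le> j \<and> j < i \<and> i \<le> g \<longrightarrow> P (Gen_a i) (Gen_b j)) \<and>
       (\<forall>i j. 1 \<le> j \<and> j < i \<and> i \<le> g \<longrightarrow> P (Gen_b i) (Gen_a j)) \<and>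
       (\<forall>i j. 1 \<le> j \<and> j < i \<and> i \<le> g \<longrightarrow> P (Gen_b i) (Gen_b j))" for P
    proof (intro iffI conjI allI impI ballI)
      fix i j assume H: "\<forall>h\<in>handles g. \<forall>h'\<in>handles g. handle_index h' < handle_index h \<longrightarrow> P h h'"
        and ij: "1 \<le> j \<and> j < i \<and> i \<le> g"
      show "P (Gen_a i) (Gen_a j)" "P (Gen_a i) (Gen_b j)" "P (Gen_b i) (Gen_a j)" "P (Gen_b i) (Gen_b j)"
        using H[THEN bspec, THEN bspec, rule_format] ij by simp_all
    next
      fix h h' assume "h \<in> handles g" "h' \<in> handles g" "handle_index h' < handle_index h"
        "(\<forall>i j. 1 \<le> j \<and> j < i \<and> i \<le> g \<longrightarrow> P (Gen_a i) (Gen_a j)) \<and>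
         (\<forall>i j. 1 \<le> j \<and> j < i \<and> i \<le> g \<longrightarrow> P (Gen_a i) (Gen_b j)) \<and>
         (\<forall>i j. 1 \<le> j \<and> j < i \<and> i \<le> g \<longrightarrow> P (Gen_b i) (Gen_a j)) \<and>
         (\<forall>i j. 1 \<le> j \<and> j < i \<and> i \<le> g \<longrightarrow> P (Gen_b i) (Gen_b j))"
      then show "P h h'" by (cases h; cases h') simp_all
    qed
    show ?thesis
      unfolding E1 E2 E3
      using F1[of "\<lambda>h. ?w h h = \<one>"] F2[of "\<lambda>h h'. ?v h h' = \<one>"] by argo
  qed
  finally show ?thesis .
qed

text \<open>The source of all admissible tuples below: if \<open>\<sigma>\<close> goes to an involution \<open>s\<close> and the handles go
into a commuting set stable under \<open>u \<mapsto> s u s\<close>, then every commutator in the relations is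
trivial, and so is \<open>\<sigma>\<^sup>2\<close>.\<close>

lemma satisfies_braid_rels_of_twisted_abelian:
  assumes f: "f \<in> braid_gens g \<rightarrow> carrier G" and s: "s = f Gen_sigma" and ss: "s \<otimes> s = \<one>"
    and A: "A \<subseteq> carrier G" "f ` handles g \<subseteq> A"
    and comm: "\<And>u v. u \<in> A \<Longrightarrow> v \<in> A \<Longrightarrow> u \<otimes> v = v \<otimes> u"
    and twist: "\<And>u. u \<in> A \<Longrightarrow> s \<otimes> u \<otimes> s \<in> A"
  shows "satisfies_rels G (braid_rels g) f"
proof -
  have fc: "f h \<in> carrier G" if "h \<in> braid_gens g" for h using f that by auto
  have sc: "s \<in> carrier G" using fc s by simp
  have invs: "inv s = s" using ss sc by (simp add: inv_equality)
  have fA: "f h \<in> A" if "h \<in> handles g" for h using A that by auto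
  have ab: "f (Gen_a i) \<in> A" "f (Gen_b i) \<in> A" if "1 \<le> i" "i \<le> g" for i
    using that by (auto intro!: fA simp: handles_def)
  have "word_eval G f (concat (map (\<lambda>i. wcomm (gen (Gen_a i)) (winv (gen (Gen_b i)))) is)) = \<one>"
    if "set is \<subseteq> {1..g}" for "is"
    using that
  proof (induction "is")
    case (Cons i js)
    have i: "1 \<le> i" "i \<le> g" using Cons.prems by auto
    have "concat (map (\<lambda>i. wcomm (gen (Gen_a i)) (winv (gen (Gen_b i)))) js) \<in> gwords (braid_gens g)"
      using Cons.prems by (auto simp: concat_in_gwords)
    moreover have "f (Gen_a i) \<otimes> inv f (Gen_b i) = inv f (Gen_b i) \<otimes> f (Gen_a i)"
      using comm[OF ab[OF i]] i fc
      by (metis braid_gens_simps(1,2) inv_closed inv_solve_left inv_solve_right m_assoc m_closed)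
    ultimately show ?case
      using Cons i fc commutator_eq_one_iff[of "f (Gen_a i)" "inv f (Gen_b i)"]
      by (simp add: word_eval_append[OF f] word_eval_wcomm[OF f] word_eval_winv[OF f]
          word_eval_gen[OF f])
  qed simp
  moreover have "set [1..<Suc g] \<subseteq> {1..g}" by auto
  ultimately have prod: "word_eval G f (concat (map (\<lambda>i. wcomm (gen (Gen_a i)) (winv (gen (Gen_b i)))) [1..<Suc g])) = \<one>"
    by blast
  have pair: "f (Gen_a i) \<otimes> (s \<otimes> f (Gen_b i) \<otimes> s \<otimes> (inv f (Gen_a i) \<otimes> inv (s \<otimes> f (Gen_b i) \<otimes> s))) = \<one>"
    if "1 \<le> i \<and> i \<le> g" for i
    using that comm[OF ab(1) twist[OF ab(2)]] subsetD[OF A(1)] ab twist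
    by (subst commutator_eq_one_iff) auto
  show ?thesis
    unfolding satisfies_braid_rels_iff[OF f s] invs ss
    using comm twist fA prod pair by auto
qed

end

section \<open>Generating a dihedral group by a reflection and further elements\<close>

text \<open>The exponent of the rotation in the left coset \<open>u {1, (c, True)}\<close>. Every such coset contains exactly
one rotation, so the offset identifies the coset, and it is \<open>0\<close> for the reflection
\<open>(c, True)\<close> itself.\<close>

definition offset :: "nat \<Rightarrow> int \<Rightarrow> int \<times> bool \<Rightarrow> int" where
  "offset m c = (\<lambda>(k, e). (k - (if e then c else 0)) mod int m)"

lemma offset_simps [simp]:
  "offset m c (k, True) = (k - c) mod int m"
  "offset m c (k, False) = k mod int m"
  by (simp_all add: offset_def)

lemma carrier_Zm: "m > 0 \<Longrightarrow> carrier (integer_mod_group m) = {0..<int m}"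
  by (simp add: carrier_integer_mod_group)

lemma subgroup_mod_add: "subgroup K (integer_mod_group m) \<Longrightarrow> x \<in> K \<Longrightarrow> y \<in> K \<Longrightarrow> (x + y) mod int m \<in> K"
  using subgroup.m_closed[of K "integer_mod_group m" x y] by simp

lemma subgroup_mod_minus:
  assumes "subgroup K (integer_mod_group m)" "x \<in> K" shows "- x mod int m \<in> K"
proof -
  have "x \<in> carrier (integer_mod_group m)" using subgroup.mem_carrier[OF assms] .
  then show ?thesis using subgroup.m_inv_closed[OF assms] by simp
qed

lemma offset_in_carrier: "m > 0 \<Longrightarrow> offset m c u \<in> carrier (integer_mod_group m)"
  by (cases u) (simp add: offset_def carrier_Zm)

lemma offset_mult:
  "offset m c (u \<otimes>\<^bsub>dihedral_model m\<^esub> v) =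
    (if snd u then offset m c u + - offset m c v mod int m else offset m c u + offset m c v) mod int m"
  by (cases u; cases v) (auto simp: offset_def mod_simps, auto simp: algebra_simps)

text \<open>These are the subgroups of the dihedral group containing the reflection \<open>(c, True)\<close>: such
a subgroup is the semidirect product of its rotations with that reflection.\<close>

lemma subgroup_offset:
  assumes m: "m > 0" and K: "subgroup K (integer_mod_group m)"
  shows "subgroup {u \<in> carrier (dihedral_model m). offset m c u \<in> K} (dihedral_model m)"
proof -
  interpret D: group "dihedral_model m" by (rule group_dihedral_model[OF m])
  show ?thesis
  proof (rule D.subgroupI)
    have "\<one>\<^bsub>dihedral_model m\<^esub> \<in> {u \<in> carrier (dihedral_model m). offset m c u \<in> K}"
      using m subgroup.one_closed[OF K] by simp
    then show "{u \<in> carrier (dihedral_model m). offset m c u \<in> K} \<noteq> {}" by blast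
  next
    fix u assume u: "u \<in> {u \<in> carrier (dihedral_model m). offset m c u \<in> K}"
    obtain k e where ke: "u = (k, e)" by (cases u)
    have "offset m c (inv\<^bsub>dihedral_model m\<^esub> u) =
        (if e then offset m c u else - offset m c u mod int m)"
      using u m by (simp add: ke inv_dihedral_model mod_simps)
    then show "inv\<^bsub>dihedral_model m\<^esub> u \<in> {u \<in> carrier (dihedral_model m). offset m c u \<in> K}"
      using u subgroup_mod_minus[OF K] by auto
  next
    fix u v assume "u \<in> {u \<in> carrier (dihedral_model m). offset m c u \<in> K}"
      "v \<in> {u \<in> carrier (dihedral_model m). offset m c u \<in> K}"
    then show "u \<otimes>\<^bsub>dihedral_model m\<^esub> v \<in> {u \<in> carrier (dihedral_model m). offset m c u \<in> K}"
      using subgroup_mod_minus[OF K] subgroup_mod_add[OF K]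
      by (auto simp: offset_mult simp del: dihedral_model_simps)
  qed auto
qed

text \<open>This is what brings in the Jordan totient: in the presence of a reflection, generating the
dihedral group is the same as generating the cyclic group by the offsets.\<close>

lemma generate_dihedral_iff:
  assumes m: "m > 0" and c: "0 \<le> c" "c < int m" and U: "U \<subseteq> carrier (dihedral_model m)"
  shows "generate (dihedral_model m) (insert (c, True) U) = carrier (dihedral_model m) \<longleftrightarrow>
    generate (integer_mod_group m) (offset m c ` U) = carrier (integer_mod_group m)"
proof -
  let ?D = "dihedral_model m" and ?Z = "integer_mod_group m"
  interpret D: group ?D by (rule group_dihedral_model[OF m])
  interpret Z: group ?Z by (rule group_integer_mod_group)
  have offU: "offset m c ` U \<subseteq> carrier ?Z" using offset_in_carrier[OF m] by auto
  have sU: "insert (c, True) U \<subseteq> carrier ?D" using U c by auto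
  show ?thesis
  proof
    assume gen: "generate ?D (insert (c, True) U) = carrier ?D"
    let ?K = "generate ?Z (offset m c ` U)"
    have K: "subgroup ?K ?Z" by (rule Z.generate_is_subgroup[OF offU])
    have "insert (c, True) U \<subseteq> {u \<in> carrier ?D. offset m c u \<in> ?K}"
      using sU subgroup.one_closed[OF K] by (auto intro: generate.incl)
    then have "carrier ?D \<subseteq> {u \<in> carrier ?D. offset m c u \<in> ?K}"
      using D.generate_subgroup_incl[OF _ subgroup_offset[OF m K]] gen by blast
    then have "k \<in> ?K" if "0 \<le> k" "k < int m" for k
      using that by (auto dest!: subsetD[of _ _ "(k, False)"])
    then have "carrier ?Z \<subseteq> ?K" by (auto simp: carrier_Zm[OF m])
    then show "?K = carrier ?Z" using Z.generate_incl[OF offU] by blast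
  next
    assume gen: "generate ?Z (offset m c ` U) = carrier ?Z"
    let ?L = "generate ?D (insert (c, True) U)"
    have L: "subgroup ?L ?D" by (rule D.generate_is_subgroup[OF sU])
    have c_in: "(c, True) \<in> ?L" by (auto intro: generate.incl)
    \<comment> \<open>A reflection \<open>u\<close> among the generators yields the rotation \<open>u (c, True)\<close>, which is given by its offset.\<close>
    let ?K = "{k \<in> carrier ?Z. (k, False) \<in> ?L}"
    have "subgroup ?K ?Z"
    proof (rule Z.subgroupI)
      have "0 \<in> ?K" using subgroup.one_closed[OF L] m by (simp add: carrier_Zm)
      then show "?K \<noteq> {}" by blast
    next
      fix k assume k: "k \<in> ?K"
      then have "inv\<^bsub>?D\<^esub> (k, False) \<in> ?L" by (auto intro: subgroup.m_inv_closed[OF L])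
      then show "inv\<^bsub>?Z\<^esub> k \<in> ?K" using k m by (simp add: carrier_Zm inv_dihedral_model)
    next
      fix k l assume kl: "k \<in> ?K" "l \<in> ?K"
      then show "k \<otimes>\<^bsub>?Z\<^esub> l \<in> ?K"
        using subgroup.m_closed[OF L, of "(k, False)" "(l, False)"] m by (simp add: carrier_Zm)
    qed auto
    moreover have "offset m c ` U \<subseteq> ?K"
    proof
      fix t assume "t \<in> offset m c ` U"
      then obtain k e where ke: "(k, e) \<in> U" "t = offset m c (k, e)" by auto
      have k: "0 \<le> k" "k < int m" using ke U by auto
      have kL: "(k, e) \<in> ?L" using ke by (auto intro: generate.incl)
      have "(t, False) = (if e then (k, e) \<otimes>\<^bsub>?D\<^esub> (c, True) else (k, e))"
        using k ke by (auto simp: offset_def)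
      then have "(t, False) \<in> ?L"
        using subgroup.m_closed[OF L kL c_in] kL by (auto split: if_splits)
      then show "t \<in> ?K" using ke offset_in_carrier[OF m] by blast
    qed
    ultimately have rot: "(k, False) \<in> ?L" if "0 \<le> k" "k < int m" for k
      using Z.generate_subgroup_incl[of "offset m c ` U" ?K] gen that by (auto simp: carrier_Zm[OF m])
    have "carrier ?D \<subseteq> ?L"
    proof
      fix u assume u: "u \<in> carrier ?D"
      obtain k e where ke: "u = (k, e)" by (cases u)
      show "u \<in> ?L"
      proof (cases e)
        case True
        have "((k - c) mod int m, False) \<otimes>\<^bsub>?D\<^esub> (c, True) \<in> ?L"
          using rot[of "(k - c) mod int m"] c_in m by (intro subgroup.m_closed[OF L]) auto
        moreover have "((k - c) mod int m, False) \<otimes>\<^bsub>?D\<^esub> (c, True) = u"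
          using u ke True by (simp add: mod_simps)
        ultimately show ?thesis by simp
      qed (use rot u ke in auto)
    qed
    then show "?L = carrier ?D" using D.generate_incl[OF sU] by blast
  qed
qed

lemma generate_integer_mod_group_killed:
  assumes m: "m \<ge> 2" and T: "T \<subseteq> carrier (integer_mod_group m)"
    and gen: "generate (integer_mod_group m) T = carrier (integer_mod_group m)"
    and killed: "\<And>t. t \<in> T \<Longrightarrow> int m dvd N * t"
  shows "int m dvd N"
proof -
  let ?Z = "integer_mod_group m" and ?K = "{k \<in> carrier (integer_mod_group m). int m dvd N * k}"
  interpret Z: group ?Z by (rule group_integer_mod_group)
  have m0: "m > 0" using m by simp
  have *: "int m dvd N * (x mod int m) \<longleftrightarrow> int m dvd N * x" for x
    by (simp add: dvd_eq_mod_eq_0 mod_mult_right_eq)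
  have "subgroup ?K ?Z"
  proof (rule Z.subgroupI)
    show "?K \<noteq> {}" using integer_mod_group_0[of m] by fastforce
  qed (use m0 in \<open>auto simp: carrier_Zm * distrib_left\<close>)
  then have "carrier ?Z \<subseteq> ?K"
    using Z.generate_subgroup_incl[of T ?K] T killed gen by auto
  moreover have "1 \<in> carrier ?Z" using m by simp
  ultimately have "1 \<in> ?K" by blast
  then show ?thesis by simp
qed

text \<open>The test used to refute generation: a multiplier \<open>N\<close> annihilating the offsets of all generators
annihilates the whole rotation group, whose exponent is \<open>m\<close>.\<close>

lemma generate_dihedral_killed:
  assumes m: "m \<ge> 2" and c: "(c, True) \<in> U" and U: "U \<subseteq> carrier (dihedral_model m)"
    and gen: "generate (dihedral_model m) U = carrier (dihedral_model m)"
    and killed: "\<And>k e. (k, e) \<in> U \<Longrightarrow> int m dvd N * (k - (if e then c else 0))"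
  shows "int m dvd N"
proof (rule generate_integer_mod_group_killed[OF m])
  have m0: "m > 0" using m by simp
  have "0 \<le> c" "c < int m" using c U by auto
  show "generate (integer_mod_group m) (offset m c ` U) = carrier (integer_mod_group m)"
    using generate_dihedral_iff[OF m0 \<open>0 \<le> c\<close> \<open>c < int m\<close> U] gen c by (simp add: insert_absorb)
  show "offset m c ` U \<subseteq> carrier (integer_mod_group m)"
    using offset_in_carrier[OF m0] by blast
  fix t assume "t \<in> offset m c ` U"
  then obtain k e where "(k, e) \<in> U" "t = (k - (if e then c else 0)) mod int m"
    by (auto simp: offset_def)
  then show "int m dvd N * t"
    using killed by (simp add: dvd_eq_mod_eq_0 mod_mult_right_eq)
qed

text \<open>The Jordan totient counts these tuples for the index set \<open>{..<k}\<close>; here the indices are the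
handle generators.\<close>

definition generating_tuples :: "'i set \<Rightarrow> nat \<Rightarrow> ('i \<Rightarrow> int) set" where
  "generating_tuples I m = {t \<in> I \<rightarrow>\<^sub>E carrier (integer_mod_group m).
      generate (integer_mod_group m) (t ` I) = carrier (integer_mod_group m)}"

lemma reindex_generating_tuple:
  assumes "bij_betw \<gamma> I' I" and "t \<in> generating_tuples I m"
  shows "(\<lambda>i\<in>I'. t (\<gamma> i)) \<in> generating_tuples I' m"
proof -
  have img: "\<gamma> ` I' = I" using assms(1) by (simp add: bij_betw_def)
  then have "(\<lambda>i\<in>I'. t (\<gamma> i)) ` I' = t ` I" by auto
  then show ?thesis using assms img by (auto simp: generating_tuples_def)
qed

lemma card_generating_tuples:
  assumes "finite I"
  shows "card (generating_tuples I m) = jordan_totient (card I) m"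
proof -
  obtain \<beta> where \<beta>: "bij_betw \<beta> {..<card I} I"
    using ex_bij_betw_nat_finite[OF assms] by (auto simp: atLeast0LessThan)
  let ?\<beta>' = "inv_into {..<card I} \<beta>"
  note \<beta>' = bij_betw_inv_into[OF \<beta>]
  have "bij_betw (\<lambda>t. \<lambda>i\<in>{..<card I}. t (\<beta> i)) (generating_tuples I m)
      (generating_tuples {..<card I} m)"
  proof (rule bij_betw_byWitness[where f' = "\<lambda>t. \<lambda>i\<in>I. t (?\<beta>' i)"])
    show "\<forall>t\<in>generating_tuples I m. (\<lambda>i\<in>I. (\<lambda>i\<in>{..<card I}. t (\<beta> i)) (?\<beta>' i)) = t"
      using bij_betwE[OF \<beta>'] bij_betw_inv_into_right[OF \<beta>]
      by (auto simp: generating_tuples_def fun_eq_iff PiE_iff extensional_def)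
    show "\<forall>t\<in>generating_tuples {..<card I} m. (\<lambda>i\<in>{..<card I}. (\<lambda>i\<in>I. t (?\<beta>' i)) (\<beta> i)) = t"
      using bij_betwE[OF \<beta>] bij_betw_inv_into_left[OF \<beta>]
      by (auto simp: generating_tuples_def fun_eq_iff PiE_iff extensional_def)
  qed (use reindex_generating_tuple \<beta> \<beta>' in blast)+
  then have "card (generating_tuples I m) = card (generating_tuples {..<card I} m)"
    by (rule bij_betw_same_card)
  then show ?thesis by (simp add: jordan_totient_def generating_tuples_def)
qed

text \<open>Each commuting, twist-stable set \<open>A\<close> meeting every coset of \<open>{1, (c, True)}\<close> once contributes
exactly a Jordan totient: tuples in \<open>A\<close> satisfy the relations automatically, they correspond to
their offset tuples, and generation is decided by the offsets.\<close>

lemma card_admissible_tuples_in_transversal: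
  assumes m: "m > 0" and c: "0 \<le> c" "c < int m" and A: "A \<subseteq> carrier (dihedral_model m)"
    and trans: "bij_betw (offset m c) A {0..<int m}"
    and comm: "\<And>u v. u \<in> A \<Longrightarrow> v \<in> A \<Longrightarrow>
      u \<otimes>\<^bsub>dihedral_model m\<^esub> v = v \<otimes>\<^bsub>dihedral_model m\<^esub> u"
    and twist: "\<And>u. u \<in> A \<Longrightarrow>
      (c, True) \<otimes>\<^bsub>dihedral_model m\<^esub> u \<otimes>\<^bsub>dihedral_model m\<^esub> (c, True) \<in> A"
  shows "card {f \<in> admissible_tuples g (dihedral_model m) (c, True). f ` handles g \<subseteq> A} =
    jordan_totient (2 * g) m"
proof -
  let ?D = "dihedral_model m" and ?Z = "integer_mod_group m"
  interpret D: group ?D by (rule group_dihedral_model[OF m])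
  let ?S = "{f \<in> admissible_tuples g ?D (c, True). f ` handles g \<subseteq> A}"
  let ?\<tau> = "inv_into A (offset m c)"
  let ?F = "\<lambda>f. \<lambda>h\<in>handles g. offset m c (f h)"
  let ?F' = "\<lambda>t. \<lambda>x\<in>braid_gens g. if x = Gen_sigma then (c, True) else ?\<tau> (t x)"
  have \<tau>: "?\<tau> k \<in> A" "offset m c (?\<tau> k) = k" if "0 \<le> k" "k < int m" for k
    using that bij_betwE[OF bij_betw_inv_into[OF trans]] bij_betw_inv_into_right[OF trans] by auto
  have \<tau>': "?\<tau> (offset m c u) = u" if "u \<in> A" for u
    using that bij_betw_inv_into_left[OF trans] by auto
  have "bij_betw ?F ?S (generating_tuples (handles g) m)"
  proof (rule bij_betw_byWitness[where f' = ?F'])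
    show "\<forall>f\<in>?S. ?F' (?F f) = f"
    proof
      fix f assume f: "f \<in> ?S"
      then have "?\<tau> (offset m c (f h)) = f h" if "h \<in> handles g" for h
        using that by (intro \<tau>') auto
      then show "?F' (?F f) = f"
        using f
        by (intro extensionalityI[of _ "braid_gens g"])
          (auto simp: admissible_tuples_def PiE_iff braid_gens_eq)
    qed
    show "\<forall>t\<in>generating_tuples (handles g) m. ?F (?F' t) = t"
    proof
      fix t assume t: "t \<in> generating_tuples (handles g) m"
      then have "0 \<le> t h \<and> t h < int m" if "h \<in> handles g" for h
        using that by (auto simp: generating_tuples_def PiE_iff carrier_Zm[OF m])
      then show "?F (?F' t) = t"
        using t \<tau>
        by (intro extensionalityI[of _ "handles g"])
          (auto simp: generating_tuples_def PiE_iff braid_gens_eq)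
    qed
    show "?F ` ?S \<subseteq> generating_tuples (handles g) m"
    proof
      fix t assume "t \<in> ?F ` ?S"
      then obtain f where f: "f \<in> ?S" and t: "t = ?F f" by blast
      have img: "t ` handles g = offset m c ` f ` handles g" by (auto simp: t)
      have "f ` braid_gens g = insert (c, True) (f ` handles g)"
        using f by (auto simp: admissible_tuples_def braid_gens_eq)
      then have "generate ?Z (t ` handles g) = carrier ?Z"
        using generate_dihedral_iff[OF m c, of "f ` handles g"] f A img
        by (auto simp: admissible_tuples_def)
      then show "t \<in> generating_tuples (handles g) m"
        using offset_in_carrier[OF m] by (auto simp: generating_tuples_def t)
    qed
    show "?F' ` generating_tuples (handles g) m \<subseteq> ?S"
    proof
      fix f assume "f \<in> ?F' ` generating_tuples (handles g) m"
      then obtain t where t: "t \<in> generating_tuples (handles g) m" and f: "f = ?F' t" by blast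
      have th: "0 \<le> t h \<and> t h < int m" if "h \<in> handles g" for h
        using t that by (auto simp: generating_tuples_def PiE_iff carrier_Zm[OF m])
      have fh: "f h = ?\<tau> (t h)" if "h \<in> handles g" for h
        using that by (auto simp: f braid_gens_eq)
      have fs: "f Gen_sigma = (c, True)" by (simp add: f)
      have fA: "f ` handles g \<subseteq> A"
        using th \<tau>(1) by (auto simp: fh)
      have fE: "f \<in> braid_gens g \<rightarrow>\<^sub>E carrier ?D"
        using fs fA A c by (auto simp: braid_gens_eq PiE_iff f split: if_splits)
      have "offset m c ` f ` handles g = t ` handles g"
        using th \<tau>(2) by (force simp: fh image_image)
      moreover have "f ` braid_gens g = insert (c, True) (f ` handles g)"
        using fs by (simp add: braid_gens_eq)
      ultimately have "generate ?D (f ` braid_gens g) = carrier ?D"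
        using generate_dihedral_iff[OF m c, of "f ` handles g"] fA A t
        by (auto simp: generating_tuples_def)
      moreover have "satisfies_rels ?D (braid_rels g) f"
        by (rule D.satisfies_braid_rels_of_twisted_abelian[OF _ fs[symmetric] _ A fA comm])
          (use fE twist in auto)
      ultimately show "f \<in> ?S"
        using fE fs fA by (simp add: admissible_tuples_def)
    qed
  qed
  then have "card ?S = card (generating_tuples (handles g) m)"
    by (rule bij_betw_same_card)
  then show ?thesis by (simp add: card_generating_tuples card_handles)
qed

section \<open>The half twist mapped to a reflection\<close>

text \<open>When \<open>\<sigma>\<close> goes to an involution \<open>s\<close>, the restriction on the order of handles disappears, because
conjugation by \<open>s\<close> exchanges the two roles: every handle image commutes with the \<open>s\<close>-twist of
every other one and of itself.\<close>

lemma (in group) braid_rels_twisted_commute: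
  assumes f: "f \<in> braid_gens g \<rightarrow> carrier G" and s: "s = f Gen_sigma" and ss: "s \<otimes> s = \<one>"
    and rels: "satisfies_rels G (braid_rels g) f"
    and h: "h \<in> handles g" "h' \<in> handles g"
  shows "f h \<otimes> (s \<otimes> f h' \<otimes> s) = s \<otimes> f h' \<otimes> s \<otimes> f h"
proof -
  have fc: "f h \<in> carrier G" if "h \<in> handles g" for h using f that by (auto simp: braid_gens_eq)
  have sc: "s \<in> carrier G" using f s by auto
  have invs: "inv s = s" using ss sc by (simp add: inv_equality)
  have ss': "s \<otimes> (s \<otimes> x) = x" if "x \<in> carrier G" for x
    using that sc ss by (simp flip: m_assoc)
  \<comment> \<open>Conjugation by the involution \<open>s\<close> moves the twist to the other factor.\<close>
  have sym: "v \<otimes> (s \<otimes> u \<otimes> s) = s \<otimes> u \<otimes> s \<otimes> v"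
    if "u \<otimes> (s \<otimes> v \<otimes> s) = s \<otimes> v \<otimes> s \<otimes> u" "u \<in> carrier G" "v \<in> carrier G" for u v
  proof -
    have "s \<otimes> (s \<otimes> v \<otimes> s \<otimes> u) \<otimes> s = s \<otimes> (u \<otimes> (s \<otimes> v \<otimes> s)) \<otimes> s"
      using that by simp
    then show ?thesis using that sc by (simp add: m_assoc ss ss')
  qed
  note R = rels[unfolded satisfies_braid_rels_iff[OF f s] invs ss]
  have ab: "f (Gen_a i) \<otimes> (s \<otimes> f (Gen_b i) \<otimes> s) = s \<otimes> f (Gen_b i) \<otimes> s \<otimes> f (Gen_a i)"
    if "1 \<le> i" "i \<le> g" for i
    using R that fc sc by (simp add: commutator_eq_one_iff)
  from h show ?thesis
  proof (cases rule: handle_pair_cases)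
    case 1
    then show ?thesis using R h by blast
  next
    case 2
    then show ?thesis using R h sym fc by blast
  next
    case 3
    then show ?thesis using R h by blast
  next
    case 4
    then show ?thesis using ab by blast
  next
    case 5
    then show ?thesis using ab sym fc h by blast
  qed
qed

text \<open>For two reflections the condition concerns the sum of their offsets rather than the difference,
because the twist negates offsets.\<close>

lemma dihedral_twisted_commute_iff:
  "(k, e) \<otimes>\<^bsub>dihedral_model m\<^esub> ((c, True) \<otimes>\<^bsub>dihedral_model m\<^esub> (l, f) \<otimes>\<^bsub>dihedral_model m\<^esub> (c, True))
    = (c, True) \<otimes>\<^bsub>dihedral_model m\<^esub> (l, f) \<otimes>\<^bsub>dihedral_model m\<^esub> (c, True) \<otimes>\<^bsub>dihedral_model m\<^esub> (k, e) \<longleftrightarrow>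
   int m dvd (if e then if f then 2 * ((k - c) + (l - c)) else 2 * l else if f then 2 * k else 0)"
  by (cases e; cases f; simp add: mod_simps; simp add: mod_eq_dvd_iff algebra_simps)

text \<open>Besides the rotations, the dihedral group of order 8 has another twist-stable abelian
transversal of \<open>{1, (c, True)}\<close>: the Klein four-group formed by the two central rotations and the
two reflections that do not commute with \<open>(c, True)\<close>.\<close>

definition klein_four :: "int \<Rightarrow> (int \<times> bool) set" where
  "klein_four c = {(0, False), (2, False), ((c + 1) mod 4, True), ((c + 3) mod 4, True)}"

lemma card_admissible_tuples_rotations:
  assumes m: "m > 0" and c: "0 \<le> c" "c < int m"
  shows "card {f \<in> admissible_tuples g (dihedral_model m) (c, True). f ` handles g \<subseteq> {0..<int m} \<times> {False}} =
    jordan_totient (2 * g) m"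
proof (rule card_admissible_tuples_in_transversal[OF m c])
  show "bij_betw (offset m c) ({0..<int m} \<times> {False}) {0..<int m}"
    by (rule bij_betw_byWitness[where f' = "\<lambda>k. (k, False)"]) auto
qed (use m in \<open>auto simp: add.commute\<close>)

lemma card_admissible_tuples_klein_four:
  assumes c: "0 \<le> c" "c < 4"
  shows "card {f \<in> admissible_tuples g (dihedral_model 4) (c, True). f ` handles g \<subseteq> klein_four c} =
    jordan_totient (2 * g) 4"
proof -
  have c4: "c \<in> {0, 1, 2, 3}" using c by auto
  show ?thesis
  proof (rule card_admissible_tuples_in_transversal)
    have "{0..<int 4} = {0, 1, 2, 3}" by auto
    then show "bij_betw (offset 4 c) (klein_four c) {0..<int 4}"
      using c4 by (elim insertE emptyE) (simp_all add: klein_four_def bij_betw_def inj_on_def, auto)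
  qed (use c4 c in \<open>auto simp: klein_four_def\<close>)
qed

text \<open>A single reflection \<open>h\<^sub>0\<close> among the handle images is very restrictive: by twisted commutation
it forces every rotation to have order at most 2, and every reflection to commute with its own
twist, so that 4 annihilates its offset. Hence 4 annihilates all offsets and \<open>m\<close> divides 4. For \<open>m = 4\<close>
some offset must be odd, it can only belong to a reflection, and comparing with that one shows
that all reflections have odd offset.\<close>

lemma admissible_tuples_reflection_cases:
  assumes m: "m > 2" and f: "f \<in> admissible_tuples g (dihedral_model m) (c, True)"
    and not_rot: "\<not> f ` handles g \<subseteq> {0..<int m} \<times> {False}"
  shows "m = 4" "f ` handles g \<subseteq> klein_four c"
proof -
  let ?D = "dihedral_model m"
  interpret D: group ?D using m by (intro group_dihedral_model) simp
  have fE: "f \<in> braid_gens g \<rightarrow> carrier ?D" and fs: "f Gen_sigma = (c, True)"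
    and rels: "satisfies_rels ?D (braid_rels g) f"
    and gen: "generate ?D (f ` braid_gens g) = carrier ?D"
    using f by (auto simp: admissible_tuples_def)
  define K E where "K h = fst (f h)" and "E h = snd (f h)" for h
  have fKE: "f h = (K h, E h)" for h by (simp add: K_def E_def)
  have Kr: "0 \<le> K h" "K h < int m" if "h \<in> handles g" for h
    using fE that by (force simp: fKE braid_gens_eq)+
  have "(c, True) \<in> carrier ?D" using fE fs by (metis PiE braid_gens_simps(3))
  then have c: "0 \<le> c" "c < int m" by auto
  have tw: "int m dvd (if E h then if E h' then 2 * ((K h - c) + (K h' - c)) else 2 * K h'
      else if E h' then 2 * K h else 0)" if "h \<in> handles g" "h' \<in> handles g" for h h'
    using D.braid_rels_twisted_commute[OF fE fs[symmetric] _ rels that]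
    unfolding fKE dihedral_twisted_commute_iff by simp
  obtain h0 where h0: "h0 \<in> handles g" "E h0"
    using not_rot Kr fKE by fastforce
  have rot: "int m dvd 2 * K h" if "h \<in> handles g" "\<not> E h" for h
    using tw[OF that(1) h0(1)] that h0 by simp
  have refl: "int m dvd 4 * (K h - c)" if "h \<in> handles g" "E h" for h
    using tw[OF that(1) that(1)] that by simp
  have killed: "int m dvd N" if "\<And>h. h \<in> handles g \<Longrightarrow> int m dvd N * (K h - (if E h then c else 0))" for N
  proof (rule generate_dihedral_killed[OF _ _ _ gen])
    show "(c, True) \<in> f ` braid_gens g" using fs by (metis braid_gens_simps(3) imageI)
    fix k e assume "(k, e) \<in> f ` braid_gens g"
    then show "int m dvd N * (k - (if e then c else 0))"
      using fs that by (fastforce simp: braid_gens_eq fKE)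
  qed (use m fE in auto)
  \<comment> \<open>The twofold multiples vanish for rotations, the fourfold ones for all handle images.\<close>
  have "int m dvd 4"
  proof (rule killed)
    fix h assume "h \<in> handles g"
    then show "int m dvd 4 * (K h - (if E h then c else 0))"
      using rot[of h] refl[of h] dvd_mult[of "int m" "2 * K h" 2] by auto
  qed
  then have "m dvd 4" by (metis int_dvd_int_iff of_nat_numeral)
  then have "m \<le> 4" "m \<noteq> 3" by (auto dest: dvd_imp_le)
  then show m4: "m = 4" using m by simp
  \<comment> \<open>Generation rules out that 2 annihilates all offsets; the exception must be a reflection.\<close>
  have "\<not> int m dvd 2" using m4 by simp
  then obtain h1 where h1: "h1 \<in> handles g" "\<not> int m dvd 2 * (K h1 - (if E h1 then c else 0))"
    using killed[of 2] by blast
  then have E1: "E h1" using rot[OF h1(1)] by (cases "E h1") simp_all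
  have "odd (K h1 - c)" using h1 E1 m4 by simp presburger
  show "f ` handles g \<subseteq> klein_four c"
  proof
    fix u assume "u \<in> f ` handles g"
    then obtain h where h: "h \<in> handles g" "u = (K h, E h)" using fKE by auto
    have Kh: "0 \<le> K h" "K h < 4" using Kr[OF h(1)] m4 by auto
    show "u \<in> klein_four c"
    proof (cases "E h")
      case True
      have "4 dvd 2 * ((K h - c) + (K h1 - c))"
        using tw[OF h(1) h1(1)] True E1 m4 by simp
      then have "odd (K h - c)" using \<open>odd (K h1 - c)\<close> by presburger
      then have "K h = (c + 1) mod 4 \<or> K h = (c + 3) mod 4" using Kh by presburger
      then show ?thesis using h True by (auto simp: klein_four_def)
    next
      case False
      then have "4 dvd 2 * K h" using rot[OF h(1)] m4 by simp
      then have "K h = 0 \<or> K h = 2" using Kh by presburger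
      then show ?thesis using h False by (auto simp: klein_four_def)
    qed
  qed
qed

text \<open>For \<open>m = 4\<close> the rotations and the Klein four-group both contribute. No tuple is counted twice,
since their common elements are the rotations of even offset, which do not generate even together with \<open>(c, True)\<close>.\<close>

lemma card_admissible_tuples_reflection:
  assumes m: "m > 2" and c: "0 \<le> c" "c < int m"
  shows "card (admissible_tuples g (dihedral_model m) (c, True)) =
    (if m = 4 then 2 else 1) * jordan_totient (2 * g) m"
proof -
  let ?T = "admissible_tuples g (dihedral_model m) (c, True)"
  let ?R = "{f \<in> ?T. f ` handles g \<subseteq> {0..<int m} \<times> {False}}"
  have fin: "finite ?T"
    by (rule finite_subset[of _ "braid_gens g \<rightarrow>\<^sub>E carrier (dihedral_model m)"])
      (auto simp: admissible_tuples_def finite_PiE)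
  have cR: "card ?R = jordan_totient (2 * g) m"
    using card_admissible_tuples_rotations[of m c] m c by simp
  show ?thesis
  proof (cases "m = 4")
    case False
    then have "?T = ?R" using admissible_tuples_reflection_cases[OF m] by blast
    then show ?thesis using cR False by simp
  next
    case True
    let ?V = "{f \<in> ?T. f ` handles g \<subseteq> klein_four c}"
    have "?T = ?R \<union> ?V" using admissible_tuples_reflection_cases[OF m] by blast
    moreover have "?R \<inter> ?V = {}"
    proof (rule ccontr)
      assume "?R \<inter> ?V \<noteq> {}"
      then obtain f where f: "f \<in> ?R" "f \<in> ?V" by blast
      have sub: "f ` handles g \<subseteq> {(0, False), (2, False)}"
        using f by (auto simp: klein_four_def)
      have fs: "f Gen_sigma = (c, True)" using f by (simp add: admissible_tuples_def)
      have "int m dvd 2"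
      proof (rule generate_dihedral_killed[where c = c and U = "f ` braid_gens g"])
        show "(c, True) \<in> f ` braid_gens g" using fs by (metis braid_gens_simps(3) imageI)
        fix k e assume "(k, e) \<in> f ` braid_gens g"
        then show "int m dvd 2 * (k - (if e then c else 0))"
          using fs sub True by (auto simp: braid_gens_eq)
      qed (use m f in \<open>auto simp: admissible_tuples_def\<close>)
      then show False using True by simp
    qed
    moreover have "card ?V = jordan_totient (2 * g) m"
      using card_admissible_tuples_klein_four[of c g] c True by simp
    ultimately show ?thesis
      using cR True fin card_Un_disjoint[of ?R ?V] by simp
  qed
qed

section \<open>The half twist mapped to a rotation\<close>

lemma dihedral_rotation_commute_iff:
  assumes "m > 0" "0 \<le> c" "c < int m"
  shows "(k, e) \<otimes>\<^bsub>dihedral_model m\<^esub> (inv\<^bsub>dihedral_model m\<^esub> (c, False)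
      \<otimes>\<^bsub>dihedral_model m\<^esub> (l, f) \<otimes>\<^bsub>dihedral_model m\<^esub> (c, False))
    = inv\<^bsub>dihedral_model m\<^esub> (c, False)
      \<otimes>\<^bsub>dihedral_model m\<^esub> (l, f) \<otimes>\<^bsub>dihedral_model m\<^esub> (c, False) \<otimes>\<^bsub>dihedral_model m\<^esub> (k, e) \<longleftrightarrow>
   int m dvd (if e then if f then 2 * (k - l + 2 * c) else 2 * l else if f then 2 * k else 0)"
  unfolding inv_dihedral_model[OF assms]
  by (cases e; cases f; simp add: mod_simps; simp add: mod_eq_dvd_iff algebra_simps)

lemma dihedral_rotation_commutator_iff:
  fixes k l c :: int and e f :: bool
  assumes m: "m > 0" and c: "0 \<le> c" "c < int m" and k: "0 \<le> k" "k < int m"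
    and w_def: "w = inv\<^bsub>dihedral_model m\<^esub> (c, False) \<otimes>\<^bsub>dihedral_model m\<^esub> (l, f)
      \<otimes>\<^bsub>dihedral_model m\<^esub> inv\<^bsub>dihedral_model m\<^esub> (c, False)"
  shows "(k, e) \<otimes>\<^bsub>dihedral_model m\<^esub> (w \<otimes>\<^bsub>dihedral_model m\<^esub>
      (inv\<^bsub>dihedral_model m\<^esub> (k, e) \<otimes>\<^bsub>dihedral_model m\<^esub> inv\<^bsub>dihedral_model m\<^esub> w))
    = (c, False) \<otimes>\<^bsub>dihedral_model m\<^esub> (c, False) \<longleftrightarrow>
   int m dvd (if e then if f then 2 * (k - l) - 2 * c else 2 * l - 2 * c
     else if f then 2 * k - 2 * c else 2 * c)"
proof -
  have w: "w = ((if f then l else l - 2 * c) mod int m, f)"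
    by (cases f) (simp_all add: w_def inv_dihedral_model[OF m c] mod_simps)
  have r: "0 \<le> x mod int m" "x mod int m < int m" for x using m by simp_all
  show ?thesis
    unfolding w inv_dihedral_model[OF m k] inv_dihedral_model[OF m r]
    by (cases e; cases f; simp add: mod_simps; simp add: mod_eq_dvd_iff algebra_simps dvd_diff_commute mod_eq_0_iff_dvd)
qed

text \<open>The relations among two handles, written out for elements \<open>(k, e)\<close> and \<open>(l, f)\<close> of the model
when \<open>\<sigma>\<close> goes to the rotation \<open>c\<close>, force that rotation to be of order at most 2. This is
where at least two handles are needed. A handle without reflections gives the claim by itself.
If a handle has one reflection and one rotation \<open>x\<close>, the relation inside it says \<open>2x = 2c\<close>, while
a reflection in the other handle gives \<open>2x = 0\<close>. If all four elements are reflections,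
then comparing one of them with both of the other handle shows that these two differ by an
element of order at most 2, whereas by the relation inside their handle twice the difference is \<open>2c\<close>.\<close>

lemma dvd_two_c_of_two_pairs:
  fixes M c k1 k2 l1 l2 :: int and e1 e2 f1 f2 :: bool
  defines "cross k e l f \<equiv> M dvd (if e then if f then 2 * (k - l + 2 * c) else 2 * l else if f then 2 * k else 0)"
    and "pair k e l f \<equiv> M dvd (if e then if f then 2 * (k - l) - 2 * c else 2 * l - 2 * c
     else if f then 2 * k - 2 * c else 2 * c)"
  assumes "pair k1 e1 l1 f1" "pair k2 e2 l2 f2"
    and "cross k1 e1 k2 e2" "cross k1 e1 l2 f2" "cross l1 f1 k2 e2" "cross l1 f1 l2 f2"
  shows "M dvd 2 * c"
proof -
  have mix: "M dvd 2 * c" if "M dvd 2 * x" "M dvd 2 * x - 2 * c" for x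
    using dvd_diff[OF that] by simp
  have refl: "M dvd 2 * c"
    if "M dvd 2 * (k1 - k2 + 2 * c)" "M dvd 2 * (k1 - l2 + 2 * c)" "M dvd 2 * (k2 - l2) - 2 * c"
    using dvd_diff[OF dvd_diff[OF that(2,1)] that(3)] by (simp add: algebra_simps)
  show ?thesis
    using assms(3-) unfolding cross_def pair_def
    by (cases e1; cases f1; cases e2; cases f2; simp only: if_True if_False; (blast intro: mix refl)?)
qed

text \<open>A generating tuple must have a reflection \<open>h\<^sub>0\<close> among the handle images. Once \<open>2c = 0\<close>, the
relations say that 2 annihilates the offsets from \<open>h\<^sub>0\<close> of all generators, including \<open>\<sigma>\<close>, so
they can only generate when \<open>m\<close> divides 2.\<close>

lemma admissible_tuples_rotation:
  assumes g: "g \<ge> 2" and m: "m > 2" and c: "0 \<le> c" "c < int m"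
  shows "admissible_tuples g (dihedral_model m) (c, False) = {}"
proof (rule ccontr)
  let ?D = "dihedral_model m"
  have m0: "m > 0" using m by simp
  interpret D: group ?D by (rule group_dihedral_model[OF m0])
  assume "admissible_tuples g ?D (c, False) \<noteq> {}"
  then obtain f where fE: "f \<in> braid_gens g \<rightarrow> carrier ?D" and fs: "f Gen_sigma = (c, False)"
    and rels: "satisfies_rels ?D (braid_rels g) f"
    and gen: "generate ?D (f ` braid_gens g) = carrier ?D"
    by (auto simp: admissible_tuples_def)
  define K E where "K h = fst (f h)" and "E h = snd (f h)" for h
  have fKE: "f h = (K h, E h)" for h by (simp add: K_def E_def)
  have Kr: "0 \<le> K h" "K h < int m" if "h \<in> handles g" for h
    using fE that by (force simp: fKE braid_gens_eq)+
  note R = rels[unfolded D.satisfies_braid_rels_iff[OF fE fs[symmetric]]]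
  have cross: "int m dvd (if E h then if E h' then 2 * (K h - K h' + 2 * c) else 2 * K h'
      else if E h' then 2 * K h else 0)"
    if "h \<in> handles g" "h' \<in> handles g" "handle_index h' < handle_index h" for h h'
    using R that unfolding fKE dihedral_rotation_commute_iff[OF m0 c] by blast
  have pair: "int m dvd (if E (Gen_a i) then if E (Gen_b i) then 2 * (K (Gen_a i) - K (Gen_b i)) - 2 * c
      else 2 * K (Gen_b i) - 2 * c else if E (Gen_b i) then 2 * K (Gen_a i) - 2 * c else 2 * c)"
    if i: "1 \<le> i" "i \<le> g" for i
  proof -
    have a: "0 \<le> K (Gen_a i)" "K (Gen_a i) < int m" using Kr i by auto
    show ?thesis
      using R i unfolding fKE dihedral_rotation_commutator_iff[OF m0 c a HOL.refl, symmetric] by blast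
  qed
  have two_c: "int m dvd 2 * c"
    by (rule dvd_two_c_of_two_pairs[OF pair[of 2] pair[of 1] cross cross cross cross])
      (use g in auto)
  have "\<exists>h\<in>handles g. E h"
  proof (rule ccontr)
    assume none: "\<not> (\<exists>h\<in>handles g. E h)"
    have "subgroup ({0..<int m} \<times> {False}) ?D"
      by (rule D.subgroupI) (use m0 in \<open>auto simp: inv_dihedral_model\<close>)
    moreover have "f ` braid_gens g \<subseteq> {0..<int m} \<times> {False}"
      using none Kr fs c by (auto simp: braid_gens_eq fKE)
    ultimately have "carrier ?D \<subseteq> {0..<int m} \<times> {False}"
      using D.generate_subgroup_incl gen by blast
    moreover have "(0, True) \<in> carrier ?D" using m by simp
    ultimately show False by blast
  qed
  then obtain h0 where h0: "h0 \<in> handles g" "E h0" by blast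
  have killed: "int m dvd 2 * (K h - (if E h then K h0 else 0))" if h: "h \<in> handles g" for h
  proof -
    \<comment> \<open>In either order, and within or across handles, the condition is this one up to multiples of \<open>2c\<close>.\<close>
    have refl: "int m dvd 2 * (K h - K h0)"
      if "int m dvd 2 * (K h - K h0 + 2 * c) \<or> int m dvd 2 * (K h0 - K h + 2 * c) \<or>
        int m dvd 2 * (K h - K h0) - 2 * c \<or> int m dvd 2 * (K h0 - K h) - 2 * c"
    proof -
      have four_c: "int m dvd 4 * c" using dvd_add[OF two_c two_c] by simp
      have d: "int m dvd 2 * (K h - K h0 + 2 * c) \<longleftrightarrow> int m dvd 2 * (K h - K h0)"
        "int m dvd 2 * (K h0 - K h + 2 * c) \<longleftrightarrow> int m dvd 2 * (K h0 - K h)"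
        "int m dvd 2 * (K h - K h0) - 2 * c \<longleftrightarrow> int m dvd 2 * (K h - K h0)"
        "int m dvd 2 * (K h0 - K h) - 2 * c \<longleftrightarrow> int m dvd 2 * (K h0 - K h)"
        using two_c four_c by (simp_all add: distrib_left dvd_add_left_iff dvd_diff_left_iff)
      show ?thesis
        using that unfolding d by (metis dvd_diff_commute right_diff_distrib)
    qed
    have rot: "int m dvd 2 * K h" if "int m dvd 2 * K h - 2 * c"
      using dvd_add[OF that two_c] by simp
    from h h0(1) show ?thesis
    proof (cases rule: handle_pair_cases)
      case 1
      then show ?thesis using cross[OF h h0(1) 1] h0 refl
        by (cases "E h"; simp only: if_True if_False diff_zero; blast)
    next
      case 2
      then show ?thesis using cross[OF h0(1) h 2] h0 refl
        by (cases "E h"; simp only: if_True if_False diff_zero; blast)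
    next
      case 3
      then show ?thesis using h0 by simp
    next
      case (4 i)
      then show ?thesis using pair[OF 4(1,2)] h0(2) refl rot unfolding 4(3,4)
        by (cases "E (Gen_a i)"; simp only: if_True if_False diff_zero; blast)
    next
      case (5 i)
      then show ?thesis using pair[OF 5(1,2)] h0(2) refl rot unfolding 5(3,4)
        by (cases "E (Gen_b i)"; simp only: if_True if_False diff_zero; blast)
    qed
  qed
  have "int m dvd 2"
  proof (rule generate_dihedral_killed[OF _ _ _ gen])
    show "(K h0, True) \<in> f ` braid_gens g"
      using imageI[of h0 "braid_gens g" f] h0 fKE[of h0] by (simp add: braid_gens_eq)
    fix k e assume "(k, e) \<in> f ` braid_gens g"
    then show "int m dvd 2 * (k - (if e then K h0 else 0))"
      using fs killed two_c by (fastforce simp: braid_gens_eq fKE)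
  qed (use m fE in auto)
  then show False using m by (auto dest: zdvd_imp_le)
qed

section \<open>The Klein four-group\<close>

text \<open>For \<open>m = 2\<close> the group is abelian of exponent 2, so the relations hold for all tuples and only
generation is to be counted, for an arbitrary image \<open>s \<noteq> 1\<close> of \<open>\<sigma>\<close>.\<close>

lemma carrier_dihedral_model_2:
  "carrier (dihedral_model 2) = {(0, False), (1, False), (0, True), (1, True)}"
  by (auto simp: dihedral_model_def)

lemma generate_dihedral_model_2_iff:
  assumes s: "s \<in> carrier (dihedral_model 2)" "s \<noteq> (0, False)" and U: "U \<subseteq> carrier (dihedral_model 2)"
  shows "generate (dihedral_model 2) (insert s U) = carrier (dihedral_model 2) \<longleftrightarrow>
    \<not> U \<subseteq> {(0, False), s}"
proof -
  let ?D = "dihedral_model 2"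
  interpret D: group ?D by (rule group_dihedral_model) simp
  have sU: "insert s U \<subseteq> carrier ?D" using s U by auto
  show ?thesis
  proof
    assume gen: "generate ?D (insert s U) = carrier ?D"
    show "\<not> U \<subseteq> {(0, False), s}"
    proof
      assume "U \<subseteq> {(0, False), s}"
      moreover have "subgroup {(0, False), s} ?D"
        by (rule D.subgroupI)
          (use s in \<open>auto simp: carrier_dihedral_model_2 inv_dihedral_model simp del: dihedral_model_simps(1)\<close>)
      ultimately have "carrier ?D \<subseteq> {(0, False), s}"
        using D.generate_subgroup_incl[of "insert s U" "{(0, False), s}"] gen by simp
      then show False by (auto simp: carrier_dihedral_model_2)
    qed
  next
    assume "\<not> U \<subseteq> {(0, False), s}"
    then obtain u where u: "u \<in> U" "u \<noteq> (0, False)" "u \<noteq> s" by blast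
    have L: "(0, False) \<in> generate ?D (insert s U)" "s \<in> generate ?D (insert s U)"
      "u \<in> generate ?D (insert s U)" "s \<otimes>\<^bsub>?D\<^esub> u \<in> generate ?D (insert s U)"
      using u generate.one[of ?D "insert s U"] by (auto intro: generate.incl generate.eng)
    have "u \<in> carrier ?D" using u U by auto
    then have "carrier ?D \<subseteq> {(0, False), s, u, s \<otimes>\<^bsub>?D\<^esub> u}"
      using s u by (auto simp: carrier_dihedral_model_2 simp del: dihedral_model_simps(1))
    then show "generate ?D (insert s U) = carrier ?D"
      using L D.generate_incl[OF sU] by blast
  qed
qed

text \<open>Two elements different from \<open>1\<close> and from each other generate the group, so a tuple fails to
generate precisely if all its handle images lie in \<open>{1, s}\<close>.\<close>

lemma card_admissible_tuples_2:
  assumes s: "s \<in> carrier (dihedral_model 2)" "s \<noteq> (0, False)"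
  shows "card (admissible_tuples g (dihedral_model 2) s) = 4 ^ (2 * g) - 2 ^ (2 * g)"
proof -
  let ?D = "dihedral_model 2"
  interpret D: group ?D by (rule group_dihedral_model) simp
  define F where "F B = (\<Pi>\<^sub>E x\<in>braid_gens g. if x = Gen_sigma then {s} else B)" for B
  have cF: "card (F B) = card B ^ (2 * g)" for B
  proof -
    have "(\<Prod>x\<in>handles g. card (if x = Gen_sigma then {s} else B)) = (\<Prod>x\<in>handles g. card B)"
      by (rule prod.cong) auto
    then show ?thesis by (simp add: F_def braid_gens_eq card_PiE card_handles)
  qed
  have rels: "satisfies_rels ?D (braid_rels g) f"
    if "f \<in> braid_gens g \<rightarrow>\<^sub>E carrier ?D" "f Gen_sigma = s" for f
    by (rule D.satisfies_braid_rels_of_twisted_abelian[where A = "carrier ?D" and s = s])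
      (use that s in \<open>auto simp: carrier_dihedral_model_2 braid_gens_eq PiE_iff simp del: dihedral_model_simps(1)\<close>)
  have gen: "generate ?D (f ` braid_gens g) = carrier ?D \<longleftrightarrow> \<not> f ` handles g \<subseteq> {(0, False), s}"
    if "f \<in> braid_gens g \<rightarrow>\<^sub>E carrier ?D" "f Gen_sigma = s" for f
    using generate_dihedral_model_2_iff[OF s, of "f ` handles g"] that by (auto simp: braid_gens_eq PiE_iff)
  have "admissible_tuples g ?D s = F (carrier ?D) - F {(0, False), s}"
  proof -
    have F: "f \<in> F B \<longleftrightarrow> f \<in> braid_gens g \<rightarrow>\<^sub>E carrier ?D \<and> f Gen_sigma = s \<and> f ` handles g \<subseteq> B"
      if "B \<subseteq> carrier ?D" for f B
      using s that by (auto simp: F_def braid_gens_eq PiE_iff image_subset_iff split: if_splits)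
    have sub: "{(0, False), s} \<subseteq> carrier ?D" using s by auto
    have img: "f ` handles g \<subseteq> carrier ?D" if "f \<in> braid_gens g \<rightarrow>\<^sub>E carrier ?D" for f
      using that by (auto simp: braid_gens_eq PiE_iff)
    show ?thesis
    proof (rule Set.set_eqI)
      fix f show "f \<in> admissible_tuples g ?D s \<longleftrightarrow> f \<in> F (carrier ?D) - F {(0, False), s}"
        unfolding admissible_tuples_def mem_Collect_eq Diff_iff F[OF subset_refl] F[OF sub]
        using rels[of f] gen[of f] img[of f] by argo
    qed
  qed
  moreover have "F {(0, False), s} \<subseteq> F (carrier ?D)"
    unfolding F_def using s by (intro PiE_mono) auto
  moreover have "finite (F {(0, False), s})" unfolding F_def by (intro finite_PiE) auto
  ultimately have "card (admissible_tuples g ?D s) = card (carrier ?D) ^ (2 * g) - card {(0, False), s} ^ (2 * g)"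
    by (simp add: card_Diff_subset cF)
  moreover have "card (carrier ?D) = 4" "card {(0, False), s} = 2"
    using s by (simp_all add: carrier_dihedral_model_2)
  ultimately show ?thesis by simp
qed

lemma jordan_totient_2: "jordan_totient k 2 = 2 ^ k - 1"
proof -
  let ?Z = "integer_mod_group 2" and ?I = "{..<k}"
  interpret Z: group ?Z by (rule group_integer_mod_group)
  have car: "carrier ?Z = {0, 1}" by (auto simp: carrier_integer_mod_group)
  have "generate ?Z T = carrier ?Z \<longleftrightarrow> \<not> T \<subseteq> {0}" if T: "T \<subseteq> carrier ?Z" for T
  proof
    assume gen: "generate ?Z T = carrier ?Z"
    show "\<not> T \<subseteq> {0}"
    proof
      assume "T \<subseteq> {0}"
      then have "generate ?Z T \<subseteq> {0}"
        using Z.generate_subgroup_incl[OF _ Z.triv_subgroup] by simp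
      then show False using gen car by auto
    qed
  next
    assume "\<not> T \<subseteq> {0}"
    then have "1 \<in> T" using T car by auto
    then have "{0, 1} \<subseteq> generate ?Z T"
      using generate.one[of ?Z T] by (auto intro: generate.incl)
    then show "generate ?Z T = carrier ?Z" using car Z.generate_incl[OF T] by auto
  qed
  moreover have "t ` ?I \<subseteq> carrier ?Z" if "t \<in> ?I \<rightarrow>\<^sub>E {0, 1}" for t
    using that by (auto simp: car)
  ultimately have "t \<in> generating_tuples ?I 2 \<longleftrightarrow> t \<in> ?I \<rightarrow>\<^sub>E {0, 1} \<and> \<not> t ` ?I \<subseteq> {0}" for t
    by (simp add: generating_tuples_def car cong: conj_cong)
  moreover have "t \<in> ?I \<rightarrow>\<^sub>E {0} \<longleftrightarrow> t \<in> ?I \<rightarrow>\<^sub>E {0, 1} \<and> t ` ?I \<subseteq> {0}" for t :: "nat \<Rightarrow> int"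
    unfolding PiE_iff by auto
  ultimately have "generating_tuples ?I 2 = (?I \<rightarrow>\<^sub>E {0, 1}) - (?I \<rightarrow>\<^sub>E {0})"
    by (intro Set.set_eqI) (simp, blast)
  moreover have "(?I \<rightarrow>\<^sub>E {0}) \<subseteq> (?I \<rightarrow>\<^sub>E {0, 1 :: int})" by (intro PiE_mono) auto
  ultimately have "card (generating_tuples ?I 2) = 2 ^ k - 1"
    by (simp add: card_Diff_subset finite_PiE card_PiE numeral_2_eq_2)
  then show ?thesis using card_generating_tuples[of ?I 2] by simp
qed

section \<open>The number of admissible epimorphisms\<close>

lemma num_admissible_epis_model:
  assumes g: "g \<ge> 2" and m: "m \<ge> 2"
  shows "num_admissible_epis g (dihedral_model m) =
    (if m = 2 then 3 * 2 ^ (2 * g - 1) else if m = 4 then 2 else 1)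
      * (m * jordan_totient (2 * g) m)"
proof -
  let ?D = "dihedral_model m"
  have "group ?D" using m by (intro group_dihedral_model) simp
  then have sum: "num_admissible_epis g ?D = (\<Sum>s\<in>carrier ?D - {(0, False)}. card (admissible_tuples g ?D s))"
    by (simp add: num_admissible_epis_eq_sum)
  show ?thesis
  proof (cases "m = 2")
    case True
    have "num_admissible_epis g ?D = card (carrier ?D - {(0, False)}) * (4 ^ (2 * g) - 2 ^ (2 * g))"
      using sum unfolding True by (simp add: card_admissible_tuples_2)
    also have "card (carrier ?D - {(0, False)}) = 3"
      by (simp add: True carrier_dihedral_model_2)
    also have "3 * (4 ^ (2 * g) - 2 ^ (2 * g)) = 3 * 2 ^ (2 * g - 1) * (2 * (2 ^ (2 * g) - 1) :: nat)"
    proof -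
      have "(4::nat) ^ (2 * g) = 2 ^ (2 * g) * 2 ^ (2 * g)" by (simp flip: power_mult_distrib)
      moreover have "(2::nat) ^ (2 * g) = 2 * 2 ^ (2 * g - 1)" using g by (simp flip: power_Suc)
      ultimately show ?thesis by (simp add: algebra_simps)
    qed
    finally show ?thesis using True by (simp add: jordan_totient_2)
  next
    case False
    then have m2: "m > 2" using m by simp
    let ?refl = "(\<lambda>c. (c, True)) ` {0..<int m}"
    have "num_admissible_epis g ?D = (\<Sum>s\<in>?refl. card (admissible_tuples g ?D s))"
      unfolding sum
    proof (rule sum.mono_neutral_right)
      show "\<forall>s\<in>carrier ?D - {(0, False)} - ?refl. card (admissible_tuples g ?D s) = 0"
        using admissible_tuples_rotation[OF g m2] by (auto simp: image_iff)
    qed auto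
    also have "\<dots> = (\<Sum>c\<in>{0..<int m}. card (admissible_tuples g ?D (c, True)))"
      by (subst sum.reindex) (auto simp: inj_on_def)
    also have "\<dots> = m * ((if m = 4 then 2 else 1) * jordan_totient (2 * g) m)"
      by (simp add: card_admissible_tuples_reflection[OF m2])
    finally show ?thesis using False by simp
  qed
qed

theorem theoremB:
  fixes g m :: nat
  assumes "g \<ge> 2" and "m \<ge> 2"
  shows "num_admissible_epis g (dihedral_group m) =
    (if m = 2 then 3 * 2 ^ (2 * g - 1) else if m = 4 then 2 else 1)
      * (m * jordan_totient (2 * g) m)"
proof -
  obtain \<psi> where "\<psi> \<in> iso (dihedral_group m) (dihedral_model m)"
    using dihedral_group_iso_model[OF assms(2)] by blast
  moreover have "group (dihedral_group m)"
    unfolding dihedral_group_def by (rule group_presented_group)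
  moreover have "group (dihedral_model m)"
    using assms(2) by (intro group_dihedral_model) simp
  ultimately have "num_admissible_epis g (dihedral_group m) = num_admissible_epis g (dihedral_model m)"
    by (intro num_admissible_epis_iso)
  then show ?thesis
    using num_admissible_epis_model[OF assms] by simp
qed

end
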